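(* Let $s\le L$ be positive integers, $\mathbf{D}\in\mathbb{R}^{N\times N}$, $\mathbf{H}\in\mathbb{R}^{N\times L}$, and consider the system $\mathbf{x}_k=\mathbf{D}\mathbf{x}_{k-1}+\mathbf{H}\mathbf{h}_k$ with inputs satisfying $\|\mathbf{h}_k\|_0\le s$. Suppose the system is $s$-sparse-controllable. Let $K^*$ be the minimum number of $s$-sparse input vectors required to steer the system from any given state to any other state, i.e. the smallest $K$ such that for all $\mathbf{x}_0,\mathbf{x}_{\mathrm{final}}\in\mathbb{R}^N$ there exist $\mathbf{h}_1,\dots,\mathbf{h}_K$ with $\|\mathbf{h}_k\|_0\le s$ and $\mathbf{x}_K=\mathbf{x}_{\mathrm{final}}$. Then $$\frac{N}{R^*_{\mathbf{H},s}}\le K^*\le\min\left\{q\left\lceil\frac{S^*}{s}\right\rceil,\ N-R^*_{\mathbf{H},s}+1\right\}\le N,$$ where $q$ is the degree of the minimal polynomial of $\mathbf{D}$, $R^*_{\mathbf{H},s}=\min\{\operatorname{rank}(\mathbf{H}),s\}$, and $$S^*=\min\Big\{|\mathcal{S}|:\ \mathcal{S}\subseteq\{1,\dots,L\},\ \operatorname{rank}\begin{bmatrix}\mathbf{D}-\lambda\mathbf{I} & \mathbf{H}_{\mathcal{S}}\end{bmatrix}=N\ \text{for all }\lambda\in\mathbb{C}\Big\}.$$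
   Context: $\|\cdot\|_0$ denotes the number of nonzero entries; $\mathbf{H}_{\mathcal{S}}$ is the submatrix of $\mathbf{H}$ formed by the columns indexed by $\mathcal{S}$. The system is $s$-sparse-controllable if for every initial state $\mathbf{x}_0\in\mathbb{R}^N$ and every final state $\mathbf{x}_{\mathrm{final}}\in\mathbb{R}^N$ there exist a finite $K$ and inputs $\mathbf{h}_1,\dots,\mathbf{h}_K$ with $\|\mathbf{h}_k\|_0\le s$ steering the system from $\mathbf{x}_0$ to $\mathbf{x}_K=\mathbf{x}_{\mathrm{final}}$. *)

theory Defs
  imports "HOL-Analysis.Analysis" "HOL-Computational_Algebra.Polynomial"
begin

text \<open>Number of nonzero entries of a vector (the l0 "norm").\<close>
definition l0 :: "'a::zero^'l \<Rightarrow> nat" where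
  "l0 h = card {j. h $ j \<noteq> 0}"

text \<open>State of x_k = D x_(k-1) + H h_k after k steps, starting from x0 (inputs h 1, h 2, ...).\<close>
fun traj :: "real^'n^'n \<Rightarrow> real^'l^'n \<Rightarrow> real^'n \<Rightarrow> (nat \<Rightarrow> real^'l) \<Rightarrow> nat \<Rightarrow> real^'n" where
  "traj D H x0 h 0 = x0"
| "traj D H x0 h (Suc k) = D *v traj D H x0 h k + H *v h (Suc k)"

text \<open>Steering from every state to every state is possible in exactly K s-sparse inputs.\<close>
definition steerable_in :: "real^'n^'n \<Rightarrow> real^'l^'n \<Rightarrow> nat \<Rightarrow> nat \<Rightarrow> bool" where
  "steerable_in D H s K \<longleftrightarrow>
     (\<forall>x0 xf. \<exists>h. (\<forall>k\<in>{1..K}. l0 (h k) \<le> s) \<and> traj D H x0 h K = xf)"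

definition sparse_controllable :: "real^'n^'n \<Rightarrow> real^'l^'n \<Rightarrow> nat \<Rightarrow> bool" where
  "sparse_controllable D H s \<longleftrightarrow>
     (\<forall>x0 xf. \<exists>K h. (\<forall>k\<in>{1..K}. l0 (h k) \<le> s) \<and> traj D H x0 h K = xf)"

definition Kstar :: "real^'n^'n \<Rightarrow> real^'l^'n \<Rightarrow> nat \<Rightarrow> nat" where
  "Kstar D H s = (LEAST K. steerable_in D H s K)"

fun mat_pow :: "'a::comm_ring_1^'n^'n \<Rightarrow> nat \<Rightarrow> 'a^'n^'n" where
  "mat_pow A 0 = mat 1"
| "mat_pow A (Suc k) = A ** mat_pow A k"

definition poly_mat :: "'a::comm_ring_1 poly \<Rightarrow> 'a^'n^'n \<Rightarrow> 'a^'n^'n" where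
  "poly_mat p A = (\<Sum>i\<le>degree p. mat (coeff p i) ** mat_pow A i)"

text \<open>Degree of the minimal polynomial (monic annihilating polynomial of least degree).\<close>
definition min_poly_degree :: "real^'n^'n \<Rightarrow> nat" where
  "min_poly_degree D = (LEAST d. \<exists>p::real poly. lead_coeff p = 1 \<and> degree p = d \<and> poly_mat p D = 0)"

text \<open>The block matrix [D - lambda I, H_S] over the complex numbers. The columns of H not in S
  are replaced by zero columns, which does not change the rank of the matrix.\<close>
definition pbh_block :: "real^'n^'n \<Rightarrow> real^'l^'n \<Rightarrow> 'l set \<Rightarrow> complex \<Rightarrow> complex^('n + 'l)^'n" where
  "pbh_block D H S z = (\<chi> i c. case c of
       Inl j \<Rightarrow> complex_of_real (D $ i $ j) - (if i = j then z else 0)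
     | Inr j \<Rightarrow> (if j \<in> S then complex_of_real (H $ i $ j) else 0))"

definition Sstar :: "real^'n^'n \<Rightarrow> real^'l^'n \<Rightarrow> nat" where
  "Sstar D H = (LEAST m. \<exists>S. card S = m \<and> (\<forall>z::complex. rank (pbh_block D H S z) = CARD('n)))"

definition Rstar :: "real^'l^'n \<Rightarrow> nat \<Rightarrow> nat" where
  "Rstar H s = min (rank H) s"

end

theory Submission
  imports Defs "HOL-Computational_Algebra.Fundamental_Theorem_Algebra"
begin

(* The states reachable from 0 in K steps form the union, over the support patterns T with
   card (T k) <= s, of the spans of the vectors D^k h_c with c in T k; as there are only countably
   many such subspaces, steering in K steps means that one of them is the whole space, and a
   sparse-controllable system is steerable in some fixed number of steps.

   Lower bound: each step contributes at most R* = min (rank H) s dimensions.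

   Upper bound N - R* + 1: a pattern is built greedily, modulo a D-invariant subspace, so that
   the first step gains R* dimensions and every later step at least one.

   Upper bound q * ceiling (S* / s): by the PBH test a set S of S* columns satisfies the Kalman
   rank condition.  S is split into ceiling (S* / s) blocks of at most s columns, each used for q
   consecutive steps, where q is the degree of the minimal polynomial; q steps of a block yield
   its whole Krylov space. *)

section \<open>Linear algebra\<close>

lemma span_Un_upper1: "A \<subseteq> span (A \<union> B)"
  using span_superset by blast

lemma span_Un_upper2: "B \<subseteq> span (A \<union> B)"
  using span_superset by blast

lemma dim_Un_le:
  fixes A B :: "'a::euclidean_space set"
  shows "dim (A \<union> B) \<le> dim A + dim B"
proof -
  obtain bA where bA: "bA \<subseteq> A" "independent bA" "A \<subseteq> span bA" "card bA = dim A"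
    using basis_exists by blast
  obtain bB where bB: "bB \<subseteq> B" "independent bB" "B \<subseteq> span bB" "card bB = dim B"
    using basis_exists by blast
  have "A \<union> B \<subseteq> span (bA \<union> bB)"
    using bA bB span_mono[of bA "bA \<union> bB"] span_mono[of bB "bA \<union> bB"] by blast
  then have "dim (A \<union> B) \<le> card (bA \<union> bB)"
    using dim_le_card bA(2) bB(2) independent_bound by blast
  also have "\<dots> \<le> card bA + card bB" by (rule card_Un_le)
  finally show ?thesis using bA bB by simp
qed

lemma dim_UN_lessThan_le:
  fixes L :: "nat \<Rightarrow> 'a::euclidean_space set"
  shows "dim (\<Union>k<K. L k) \<le> (\<Sum>k<K. dim (L k))"
proof (induction K)
  case (Suc K)
  have "dim (\<Union>k<Suc K. L k) \<le> dim (L K) + dim (\<Union>k<K. L k)"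
    using dim_Un_le[of "L K"] by (simp add: lessThan_Suc)
  then show ?case using Suc by simp
qed simp

lemma exists_subset_dim_add:
  fixes f :: "'c \<Rightarrow> 'a::euclidean_space"
  assumes "finite B" "m \<le> dim (X \<union> f ` B) - dim X"
  shows "\<exists>B'\<subseteq>B. card B' = m \<and> dim (X \<union> f ` B') = dim X + m"
  using assms(2)
proof (induction m)
  case 0
  show ?case by (intro exI[of _ "{}"]) auto
next
  case (Suc m)
  then obtain B' where B': "B' \<subseteq> B" "card B' = m" "dim (X \<union> f ` B') = dim X + m"
    by auto
  have "\<exists>b\<in>B. f b \<notin> span (X \<union> f ` B')"
  proof (rule ccontr)
    assume "\<not> ?thesis"
    then have "X \<union> f ` B \<subseteq> span (X \<union> f ` B')" using span_superset by blast
    then have "dim (X \<union> f ` B) \<le> dim (X \<union> f ` B')" by (rule dim_mono)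
    with Suc.prems B'(3) show False by simp
  qed
  then obtain b where b: "b \<in> B" "f b \<notin> span (X \<union> f ` B')" by blast
  have "b \<notin> B'" using b(2) span_superset[of "X \<union> f ` B'"] by blast
  moreover have "X \<union> f ` insert b B' = insert (f b) (X \<union> f ` B')" by auto
  ultimately show ?case
    using B' b dim_insert[of "f b" "X \<union> f ` B'"] finite_subset[OF B'(1) assms(1)]
    by (intro exI[of _ "insert b B'"]) auto
qed

lemma exists_subset_span_eq:
  fixes f :: "'c \<Rightarrow> 'a::euclidean_space"
  assumes "finite B"
  shows "\<exists>B'\<subseteq>B. card B' = dim (X \<union> f ` B) - dim X \<and> span (X \<union> f ` B') = span (X \<union> f ` B)"
proof -
  obtain B' where B': "B' \<subseteq> B" "card B' = dim (X \<union> f ` B) - dim X"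
      "dim (X \<union> f ` B') = dim X + (dim (X \<union> f ` B) - dim X)"
    using exists_subset_dim_add[OF assms order_refl] by blast
  have "dim X \<le> dim (X \<union> f ` B)" by (rule dim_subset) auto
  moreover have "span (X \<union> f ` B') \<subseteq> span (X \<union> f ` B)" using B'(1) by (intro span_mono) auto
  ultimately have "span (X \<union> f ` B') = span (X \<union> f ` B)"
    using B'(3) by (intro subspace_dim_equal) simp_all
  with B' show ?thesis by blast
qed

text \<open>Completing \<open>Z\<close> to \<open>V\<close> takes \<open>dim V - dim Z\<close> vectors, whose images add at most that much.\<close>
lemma dim_Un_linear_image_le:
  fixes f :: "'a::euclidean_space \<Rightarrow> 'b::euclidean_space"
  assumes "linear f" "subspace V" "Z \<subseteq> V"
  shows "dim (Y \<union> f ` V) + dim Z \<le> dim (Y \<union> f ` Z) + dim V"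
proof -
  obtain B where B: "B \<subseteq> V" "independent B" "V \<subseteq> span B" "card B = dim V"
    using basis_exists by blast
  have "span (Z \<union> B) \<subseteq> V" using B(1) assms(2,3) by (intro span_minimal) auto
  moreover have "V \<subseteq> span (Z \<union> B)" using B(3) span_mono[of B "Z \<union> B"] by blast
  moreover obtain B' where B': "B' \<subseteq> B" "card B' = dim (Z \<union> id ` B) - dim Z"
      "span (Z \<union> id ` B') = span (Z \<union> id ` B)"
    using exists_subset_span_eq[of B Z id] B(2) independent_bound by blast
  ultimately have V: "V = span (Z \<union> B')" and cardB': "card B' = dim V - dim Z"
    by (auto dest: span_eq_dim)
  have fin: "finite B'" using B'(1) B(2) independent_bound finite_subset by blast
  have "f ` V = span (f ` Z \<union> f ` B')"
    unfolding V by (simp add: span_linear_image[OF assms(1), symmetric] image_Un)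
  moreover have "span (f ` Z \<union> f ` B') \<subseteq> span ((Y \<union> f ` Z) \<union> f ` B')"
    by (rule span_mono) blast
  ultimately have "Y \<union> f ` V \<subseteq> span ((Y \<union> f ` Z) \<union> f ` B')"
    using span_Un_upper1[of Y "f ` Z \<union> f ` B'"] by (simp add: Un_assoc)
  then have "dim (Y \<union> f ` V) \<le> dim ((Y \<union> f ` Z) \<union> f ` B')"
    by (metis dim_mono dim_span)
  also have "\<dots> \<le> dim (Y \<union> f ` Z) + dim (f ` B')" by (rule dim_Un_le)
  also have "dim (f ` B') \<le> card (f ` B')"
    by (rule dim_le_card[OF span_superset]) (simp add: fin)
  also have "\<dots> \<le> card B'" by (rule card_image_le[OF fin])
  finally show ?thesis
    using cardB' dim_subset[OF assms(3)] by linarith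
qed

lemma span_Un_image_span:
  assumes "linear f" "f ` X \<subseteq> X"
  shows "span (X \<union> f ` span (X \<union> C)) = span (X \<union> f ` C)"
proof -
  have "f ` span (X \<union> C) = span (f ` X \<union> f ` C)"
    by (simp add: span_linear_image[OF assms(1), symmetric] image_Un)
  also have "\<dots> \<subseteq> span (X \<union> f ` C)" using assms(2) by (intro span_mono) blast
  finally have "X \<union> f ` span (X \<union> C) \<subseteq> span (X \<union> f ` C)"
    using span_Un_upper1[of X "f ` C"] by (rule Un_least[rotated])
  moreover have "f ` C \<subseteq> f ` span (X \<union> C)"
    using span_Un_upper2[of C X] by (rule image_mono)
  then have "X \<union> f ` C \<subseteq> span (X \<union> f ` span (X \<union> C))"
    using span_Un_upper1[of X "f ` span (X \<union> C)"] span_Un_upper2[of "f ` span (X \<union> C)" X]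
    by (meson Un_least subset_trans)
  ultimately show ?thesis by (simp add: span_eq)
qed

lemma span_Un_image_shift:
  assumes "linear f" "f ` X \<subseteq> X" "V \<subseteq> span (X \<union> f ` V \<union> C)"
  shows "span (X \<union> f ` V) \<subseteq> span (X \<union> f ` span (X \<union> f ` V) \<union> f ` C)"
proof (rule span_minimal)
  let ?W = "span (X \<union> f ` span (X \<union> f ` V) \<union> f ` C)"
  have "f ` V \<subseteq> f ` span (X \<union> f ` V \<union> C)" using assms(3) by (rule image_mono)
  also have "\<dots> = span (f ` X \<union> f ` f ` V \<union> f ` C)"
    by (simp add: span_linear_image[OF assms(1), symmetric] image_Un)
  also have "\<dots> \<subseteq> ?W"
  proof (rule span_mono)
    have "f ` f ` V \<subseteq> f ` span (X \<union> f ` V)"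
      using span_Un_upper2[of "f ` V" X] by (rule image_mono)
    then show "f ` X \<union> f ` f ` V \<union> f ` C \<subseteq> X \<union> f ` span (X \<union> f ` V) \<union> f ` C"
      using assms(2) by blast
  qed
  finally have "f ` V \<subseteq> ?W" .
  moreover have "X \<subseteq> ?W" using span_Un_upper1[of X] by (simp add: Un_assoc)
  ultimately show "X \<union> f ` V \<subseteq> ?W" by (rule Un_least[rotated])
qed simp

lemma subspace_chain_reaches:
  fixes Y :: "nat \<Rightarrow> 'a::euclidean_space set"
  assumes mono: "\<And>j. Y j \<subseteq> Y (Suc j)" and bounded: "\<And>j. Y j \<subseteq> W"
    and stable: "\<And>j. Y (Suc j) = Y j \<Longrightarrow> Y j = W"
    and subspaces: "\<And>j. subspace (Y j)"
  shows "Y (j + (dim W - dim (Y j))) = W"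
proof (induction "dim W - dim (Y j)" arbitrary: j rule: less_induct)
  case less
  have reach: "Y (j + m) = W" if "Y j = W" for m
    using that lift_Suc_mono_le[of Y, OF mono, of j "j + m"] bounded[of "j + m"] by auto
  show ?case
  proof (cases "Y (Suc j) = Y j")
    case True
    then show ?thesis using reach stable by blast
  next
    case False
    then have "Y j \<subset> Y (Suc j)" using mono by blast
    then have dim_less: "dim (Y j) < dim (Y (Suc j))"
      using dim_psubset subspaces span_eq_iff by metis
    moreover have "dim (Y (Suc j)) \<le> dim W" using bounded by (rule dim_subset)
    ultimately have IH: "Y (Suc j + (dim W - dim (Y (Suc j)))) = W"
      and "Suc j + (dim W - dim (Y (Suc j))) \<le> j + (dim W - dim (Y j))"
      using less[of "Suc j"] by linarith+
    then have "Y (Suc j + (dim W - dim (Y (Suc j)))) \<subseteq> Y (j + (dim W - dim (Y j)))"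
      using lift_Suc_mono_le[of Y, OF mono] by blast
    then show ?thesis using IH bounded by blast
  qed
qed

lemma countable_subspace_cover:
  fixes F :: "'a::euclidean_space set set"
  assumes "countable F" "\<And>S. S \<in> F \<Longrightarrow> subspace S" "\<Union>F = UNIV"
  shows "UNIV \<in> F"
proof (rule ccontr)
  assume "UNIV \<notin> F"
  have "negligible S" if "S \<in> F" for S
  proof (rule negligible_lowdim)
    have "span S \<noteq> UNIV" using \<open>UNIV \<notin> F\<close> assms(2)[OF that] that span_eq_iff by metis
    then show "dim S < DIM('a)" using dim_eq_full dim_subset_UNIV[of S] le_neq_implies_less by blast
  qed
  then have "negligible (\<Union>F)" using assms(1) by blast
  then show False using assms(3) by simp
qed

context finite_dimensional_vector_space
begin

lemma exists_linear_recurrence: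
  fixes f :: "nat \<Rightarrow> 'b"
  shows "\<exists>m c. f m = (\<Sum>j<m. scale (c j) (f j))"
proof -
  have "\<exists>m. f m \<in> span (f ` {..<m})"
  proof (rule ccontr)
    assume none: "\<not> ?thesis"
    have "dim (f ` {..<m}) = m" for m
    proof (induction m)
      case (Suc m)
      have "f ` {..<Suc m} = insert (f m) (f ` {..<m})" by (auto simp: lessThan_Suc)
      then show ?case using dim_insert[of "f m" "f ` {..<m}"] none Suc by simp
    qed simp
    then show False using dim_subset_UNIV[of "f ` {..<Suc dimension}"] by simp
  qed
  then obtain m where m: "f m \<in> span (f ` {..<m})" and least: "\<And>i. i < m \<Longrightarrow> f i \<notin> span (f ` {..<i})"
    using exists_least_iff[of "\<lambda>m. f m \<in> span (f ` {..<m})"] by blast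
  have "inj_on f {..<m}"
  proof (rule inj_onI)
    fix i j assume ij: "i \<in> {..<m}" "j \<in> {..<m}" "f i = f j"
    show "i = j"
    proof (rule ccontr)
      assume "i \<noteq> j"
      then have "f (max i j) = f (min i j)" "min i j < max i j"
        using ij(3) by (auto simp: max_def min_def)
      then have "f (max i j) \<in> f ` {..<max i j}" by (metis imageI lessThan_iff)
      then show False using least[of "max i j"] ij(1,2) span_base by fastforce
    qed
  qed
  obtain u where "f m = (\<Sum>v\<in>f ` {..<m}. scale (u v) v)"
    using m span_finite[of "f ` {..<m}"] by auto
  also have "\<dots> = (\<Sum>j<m. scale (u (f j)) (f j))"
    by (subst sum.reindex[OF \<open>inj_on f {..<m}\<close>]) simp
  finally show ?thesis by (intro exI[of _ m] exI[of _ "\<lambda>j. u (f j)"])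
qed

end

lemma row_eq_transpose_mult_axis: "row i M = transpose M *v axis i 1"
  by (simp add: vec_eq_iff row_def transpose_def matrix_vector_mult_def axis_def
      if_distrib[of "\<lambda>a. _ * a"] cong: if_cong)

lemma rank_less_card_if_left_null:
  fixes M :: "'a::field^'m^'n"
  assumes "x \<noteq> 0" "x v* M = 0"
  shows "rank M < CARD('n)"
proof -
  let ?f = "(*v) (transpose M)"
  have indep: "vec.independent {x}" using assms(1) by (simp add: vec.independent_insert)
  define B where "B = vec.extend_basis {x}"
  have B: "x \<in> B" "vec.independent B" "vec.span B = UNIV"
    using vec.extend_basis_superset[OF indep] vec.independent_extend_basis[OF indep]
      vec.span_extend_basis[OF indep] unfolding B_def by auto
  have fin: "finite B" using B(2) by (rule vec.finiteI_independent)
  have "card B = CARD('n)"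
    using vec.dim_eq_card_independent[OF B(2)] vec.dim_span[of B] B(3)
      vec_dim_card[where 'a='a and 'n='n]
    by simp
  have "rows M \<subseteq> ?f ` vec.span B"
    unfolding rows_def B(3) by (auto simp: row_eq_transpose_mult_axis)
  also have "\<dots> = vec.span (?f ` B)" by (rule vec.span_image[symmetric])
  also have "\<dots> \<subseteq> vec.span (?f ` (B - {x}))"
  proof (rule vec.span_mono[THEN subset_trans[OF _ equalityD1]])
    show "?f ` B \<subseteq> insert 0 (?f ` (B - {x}))" using assms(2) by auto
    show "vec.span (insert 0 (?f ` (B - {x}))) = vec.span (?f ` (B - {x}))" by simp
  qed
  finally have "rank M \<le> card (?f ` (B - {x}))"
    unfolding row_rank_def_gen by (rule vec.dim_le_card) (simp add: fin)
  also have "\<dots> \<le> card (B - {x})" by (rule card_image_le) (simp add: fin)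
  also have "\<dots> < CARD('n)" using \<open>card B = CARD('n)\<close> B(1) fin by (simp add: card_Diff_subset)
  finally show ?thesis .
qed

lemma rank_eq_card_if_left_null_trivial:
  fixes M :: "'a::field^'m^'n"
  assumes "\<And>x. x v* M = 0 \<Longrightarrow> x = 0"
  shows "rank M = CARD('n)"
proof -
  let ?f = "(*v) (transpose M)"
  have rows: "rows M = ?f ` cart_basis"
    unfolding rows_def cart_basis_def by (auto simp: row_eq_transpose_mult_axis)
  have "inj_on ?f (vec.span cart_basis)"
    unfolding vec.inj_on_iff_eq_0[OF vec.subspace_span] using assms by simp
  then have "vec.dim (?f ` cart_basis) = vec.dim (cart_basis :: ('a^'n) set)"
    by (rule vec.dim_image_eq[OF matrix_vector_mul_linear_gen])
  also have "\<dots> = CARD('n)"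
    using vec.dim_span[of "cart_basis :: ('a^'n) set"] vec_dim_card[where 'a='a and 'n='n]
    by (simp add: vec.span_Basis)
  finally show ?thesis unfolding row_rank_def_gen rows .
qed

section \<open>Matrix powers and polynomials of matrices\<close>

lemma mat_pow_Suc_mult_vec: "mat_pow D (Suc k) *v v = D *v (mat_pow D k *v v)"
  by (simp add: matrix_vector_mul_assoc)

lemma mat_pow_add_mult_vec: "mat_pow D (a + b) *v v = mat_pow D a *v (mat_pow D b *v v)"
  by (induction a) (auto simp: matrix_vector_mul_assoc[symmetric])

lemma mat_pow_Suc_mult_vec': "mat_pow D (Suc k) *v v = mat_pow D k *v (D *v v)"
  using mat_pow_add_mult_vec[of D k 1 v] by (simp add: matrix_vector_mul_assoc)

lemma mat_pow_commute_mult_vec: "mat_pow D k *v (D *v v) = D *v (mat_pow D k *v v)"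
  by (simp only: mat_pow_Suc_mult_vec'[symmetric] mat_pow_Suc_mult_vec)

lemma image_mat_pow_Suc: "(*v) (mat_pow D m) ` (*v) D ` V = (*v) (mat_pow D (Suc m)) ` V"
  unfolding image_image by (rule image_cong) (simp_all only: mat_pow_Suc_mult_vec')

lemma mat_pow_mult_vec_mem:
  assumes "(*v) D ` V \<subseteq> V" "x \<in> V"
  shows "mat_pow D k *v x \<in> V"
proof (induction k)
  case (Suc k)
  then show ?case unfolding mat_pow_Suc_mult_vec using assms(1) by blast
qed (use assms in simp)

lemma column_matrix_mult: "column c (D ** H) = D *v column c H"
  by (simp add: column_def matrix_matrix_mult_def matrix_vector_mult_def vec_eq_iff)

lemma span_invariant:
  fixes D :: "real^'n^'n"
  assumes "(*v) D ` S \<subseteq> span S"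
  shows "(*v) D ` span S \<subseteq> span S"
  using assms by (simp add: span_linear_image[symmetric] span_minimal)

lemma mat_mult_vec: "mat c *v x = c *s x"
  by (simp add: vec_eq_iff matrix_vector_mult_def mat_def if_distrib[of "\<lambda>a. a * _"] cong: if_cong)

lemma mat_mult_scaleR: "mat c ** (M::real^'n^'n) = c *\<^sub>R M"
  by (simp add: vec_eq_iff matrix_matrix_mult_def mat_def if_distrib[of "\<lambda>a. a * _"] cong: if_cong)

lemma sum_matrix_mult_vec: "sum f S *v (v::'a::comm_semiring_1^'n) = (\<Sum>j\<in>S. f j *v v)"
proof (induction S rule: infinite_finite_induct)
  case (insert x F) then show ?case by (simp add: matrix_vector_mult_add_rdistrib)
qed auto

lemma poly_mat_mult_vec_bound:
  assumes "degree p \<le> n"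
  shows "poly_mat p M *v w = (\<Sum>i\<le>n. coeff p i *s (mat_pow M i *v w))"
proof -
  have "poly_mat p M *v w = (\<Sum>i\<le>degree p. coeff p i *s (mat_pow M i *v w))"
    unfolding poly_mat_def sum_matrix_mult_vec
      by (simp add: matrix_vector_mul_assoc[symmetric] mat_mult_vec)
  also have "\<dots> = (\<Sum>i\<le>n. coeff p i *s (mat_pow M i *v w))"
    using assms by (intro sum.mono_neutral_left) (auto simp: coeff_eq_0)
  finally show ?thesis .
qed

lemma poly_mat_linear_factor_mult_vec:
  fixes M :: "'a::field^'n^'n"
  shows "poly_mat ([:-r, 1:] * q) M *v w = M *v (poly_mat q M *v w) - r *s (poly_mat q M *v w)"
proof -
  define n where "n = Suc (degree q)"
  have "degree ([:-r, 1:] * q) \<le> n"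
    unfolding n_def using degree_mult_le[of "[:-r, 1:]" q] by simp
  then have "poly_mat ([:-r, 1:] * q) M *v w
      = (\<Sum>i\<le>n. coeff (pCons 0 q) i *s (mat_pow M i *v w)) - r *s (\<Sum>i\<le>n. coeff q i *s (mat_pow M i *v w))"
    by (simp add: poly_mat_mult_vec_bound vector_sadd_rdistrib sum.distrib vec_eq_iff sum_distrib_left
        sum_subtractf algebra_simps)
  also have "(\<Sum>i\<le>n. coeff (pCons 0 q) i *s (mat_pow M i *v w)) = M *v (poly_mat q M *v w)"
    unfolding n_def sum.atMost_Suc_shift poly_mat_mult_vec_bound[OF order_refl]
    by (simp add: vec.sum vec.scale matrix_vector_mul_assoc[symmetric])
  also have "(\<Sum>i\<le>n. coeff q i *s (mat_pow M i *v w)) = poly_mat q M *v w"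
    by (rule poly_mat_mult_vec_bound[symmetric]) (simp add: n_def)
  finally show ?thesis .
qed

lemma monic_recurrence_poly:
  fixes c :: "nat \<Rightarrow> 'a::comm_ring_1" and m :: nat
  defines "p \<equiv> monom 1 m - (\<Sum>j<m. monom (c j) j)"
  shows "coeff p i = (if i = m then 1 else 0) - (if i < m then c i else 0)"
    and "degree p = m" and "lead_coeff p = 1"
proof -
  show coeff_p: "coeff p i = (if i = m then 1 else 0) - (if i < m then c i else 0)" for i
    unfolding p_def by (simp add: coeff_sum)
  show "degree p = m" by (intro antisym degree_le le_degree) (simp_all add: coeff_p)
  then show "lead_coeff p = 1" by (simp add: coeff_p)
qed

lemma exists_annihilating_poly: "\<exists>p::real poly. lead_coeff p = 1 \<and> poly_mat p D = 0"
  for D :: "real^'n^'n"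
proof -
  obtain m c where recurrence: "mat_pow D m = (\<Sum>j<m. c j *\<^sub>R mat_pow D j)"
    using exists_linear_recurrence[of "mat_pow D"] by blast
  define p :: "real poly" where "p = monom 1 m - (\<Sum>j<m. monom (c j) j)"
  note p = monic_recurrence_poly[of m c, folded p_def]
  have "poly_mat p D = (\<Sum>i<m. coeff p i *\<^sub>R mat_pow D i) + mat_pow D m"
    unfolding poly_mat_def p(2) by (simp add: mat_mult_scaleR lessThan_Suc_atMost[symmetric] p(1))
  moreover have "(\<Sum>i<m. coeff p i *\<^sub>R mat_pow D i) = - mat_pow D m"
    unfolding recurrence by (simp add: p(1) sum_negf)
  ultimately show ?thesis using p(3) by auto
qed

lemma degree_annihilating_poly_pos:
  fixes D :: "real^'n^'n"
  assumes "lead_coeff p = 1" "poly_mat p D = 0"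
  shows "0 < degree p"
proof (rule ccontr)
  assume "\<not> 0 < degree p"
  then have "poly_mat p D = mat 1" using assms(1) unfolding poly_mat_def by simp
  moreover have "(mat 1 :: real^'n^'n) $ i $ i = 1" for i by (simp add: mat_def)
  ultimately show False using assms(2) by (metis zero_index zero_neq_one)
qed

lemma mat_pow_mult_vec_in_span_lower_powers:
  fixes D :: "real^'n^'n"
  assumes p: "lead_coeff p = 1" "poly_mat p D = 0"
  shows "mat_pow D j *v v \<in> span ((\<lambda>i. mat_pow D i *v v) ` {..<degree p})"
proof -
  define q where "q = degree p"
  define P where "P = span ((\<lambda>i. mat_pow D i *v v) ` {..<q})"
  have "0 < q" unfolding q_def by (rule degree_annihilating_poly_pos[OF p])
  have "0 = (\<Sum>i<Suc q. coeff p i *s (mat_pow D i *v v))"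
    using poly_mat_mult_vec_bound[of p "degree p" D v] p(2) unfolding q_def
    by (simp add: lessThan_Suc_atMost)
  then have "mat_pow D q *v v = - (\<Sum>i<q. coeff p i *s (mat_pow D i *v v))"
    using p(1) unfolding q_def by (simp add: eq_neg_iff_add_eq_0 add.commute)
  also have "\<dots> \<in> P"
    unfolding P_def scalar_mult_eq_scaleR by (intro span_neg span_sum span_mul span_base) auto
  finally have top: "mat_pow D q *v v \<in> P" .
  have "(*v) D ` P \<subseteq> P" unfolding P_def
  proof (rule span_invariant)
    show "(*v) D ` (\<lambda>i. mat_pow D i *v v) ` {..<q} \<subseteq> span ((\<lambda>i. mat_pow D i *v v) ` {..<q})"
    proof
      fix x assume "x \<in> (*v) D ` (\<lambda>i. mat_pow D i *v v) ` {..<q}"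
      then obtain i where i: "i < q" "x = mat_pow D (Suc i) *v v"
        by (auto simp flip: mat_pow_Suc_mult_vec)
      show "x \<in> span ((\<lambda>i. mat_pow D i *v v) ` {..<q})"
      proof (cases "Suc i < q")
        case True
        then show ?thesis unfolding i(2) by (intro span_base) blast
      next
        case False
        then have "Suc i = q" using i(1) by simp
        then show ?thesis using top unfolding i(2) P_def by simp
      qed
    qed
  qed
  moreover have "v \<in> P" using \<open>0 < q\<close> unfolding P_def
    by (intro span_base image_eqI[of _ _ 0]) simp_all
  ultimately have "mat_pow D j *v v \<in> P" by (rule mat_pow_mult_vec_mem)
  then show ?thesis unfolding P_def q_def .
qed

lemma eigenvector_if_annihilated:
  fixes M :: "complex^'n^'n"
  assumes W: "vec.subspace W" "(*v) M ` W \<subseteq> W" and w: "w \<in> W" "w \<noteq> 0"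
  shows "p \<noteq> 0 \<Longrightarrow> poly_mat p M *v w = 0 \<Longrightarrow> \<exists>v z. v \<in> W \<and> v \<noteq> 0 \<and> M *v v = z *s v"
proof (induction "degree p" arbitrary: p rule: less_induct)
  case less
  show ?case
  proof (cases "degree p = 0")
    case True
    then have "poly_mat p M *v w = coeff p 0 *s w"
      using poly_mat_mult_vec_bound[of p 0 M w] by simp
    moreover have "coeff p 0 \<noteq> 0" using True less.prems(1) by (metis leading_coeff_0_iff)
    ultimately show ?thesis using less.prems(2) w(2) by (simp add: vec_eq_iff)
  next
    case False
    then have "\<not> constant (poly p)" by (simp add: constant_degree)
    then obtain r where "poly p r = 0" using fundamental_theorem_of_algebra by blast
    then obtain q where q: "p = [:-r, 1:] * q" by (metis dvdE poly_eq_0_iff_dvd)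
    with less.prems(1) have "q \<noteq> 0" by auto
    then have "degree q < degree p" using q degree_mult_eq[of "[:-r, 1:]" q] by simp
    define u where "u = poly_mat q M *v w"
    have "u \<in> W"
      unfolding u_def poly_mat_mult_vec_bound[OF order_refl]
      by (intro vec.subspace_sum[OF W(1)] vec.subspace_scale[OF W(1)] mat_pow_mult_vec_mem[OF W(2) w(1)])
    moreover have "M *v u = r *s u"
      using less.prems(2) unfolding q poly_mat_linear_factor_mult_vec u_def by simp
    ultimately show ?thesis
      using less.hyps[OF \<open>degree q < degree p\<close> \<open>q \<noteq> 0\<close>] unfolding u_def by blast
  qed
qed

lemma invariant_subspace_has_eigenvector:
  fixes M :: "complex^'n^'n"
  assumes "vec.subspace W" "(*v) M ` W \<subseteq> W" "w \<in> W" "w \<noteq> 0"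
  shows "\<exists>v z. v \<in> W \<and> v \<noteq> 0 \<and> M *v v = z *s v"
proof -
  obtain m c where recurrence: "mat_pow M m *v w = (\<Sum>j<m. c j *s (mat_pow M j *v w))"
    using vec.exists_linear_recurrence[of "\<lambda>j. mat_pow M j *v w"] by blast
  define p where "p = monom 1 m - (\<Sum>j<m. monom (c j) j)"
  note p = monic_recurrence_poly[of m c, folded p_def]
  have "poly_mat p M *v w = (\<Sum>i\<le>m. coeff p i *s (mat_pow M i *v w))"
    using poly_mat_mult_vec_bound[of p m M w] p(2) by simp
  also have "\<dots> = (\<Sum>i<m. coeff p i *s (mat_pow M i *v w)) + mat_pow M m *v w"
    by (simp add: lessThan_Suc_atMost[symmetric] p(1))
  also have "\<dots> = 0"
    unfolding recurrence by (simp add: p(1) vector_sadd_rdistrib[symmetric] sum.distrib[symmetric])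
  finally have "poly_mat p M *v w = 0" .
  moreover have "p \<noteq> 0" using p(3) by auto
  ultimately show ?thesis using eigenvector_if_annihilated[OF assms] by blast
qed

section \<open>Krylov vectors and support patterns\<close>

abbreviation column_set :: "'a^'l^'n \<Rightarrow> 'l set \<Rightarrow> ('a^'n) set" where
  "column_set H G \<equiv> (\<lambda>c. column c H) ` G"

definition krylov_vecs :: "real^'n^'n \<Rightarrow> real^'l^'n \<Rightarrow> 'l set \<Rightarrow> (real^'n) set" where
  "krylov_vecs D H G = {mat_pow D k *v column c H | k c. c \<in> G}"

text \<open>In a pattern \<open>T\<close> of length \<open>K\<close>, \<open>T k\<close> bounds the support of the input applied \<open>k\<close> steps
  before the end, i.e. of \<open>h (K - k)\<close>, because that input reaches the final state through \<open>D^k\<close>.\<close>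
definition pattern_vecs :: "real^'n^'n \<Rightarrow> real^'l^'n \<Rightarrow> (nat \<Rightarrow> 'l set) \<Rightarrow> nat \<Rightarrow> (real^'n) set" where
  "pattern_vecs D H T K = {mat_pow D k *v column c H | k c. k < K \<and> c \<in> T k}"

lemma column_set_subset_krylov_vecs: "column_set H G \<subseteq> krylov_vecs D H G"
proof
  fix x assume "x \<in> column_set H G"
  then obtain c where "c \<in> G" "x = mat_pow D 0 *v column c H" by auto
  then show "x \<in> krylov_vecs D H G" unfolding krylov_vecs_def by blast
qed

lemma krylov_vecs_mono: "G \<subseteq> G' \<Longrightarrow> krylov_vecs D H G \<subseteq> krylov_vecs D H G'"
  unfolding krylov_vecs_def by blast

lemma krylov_vecs_subset:
  assumes "(*v) D ` V \<subseteq> V" "column_set H G \<subseteq> V"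
  shows "krylov_vecs D H G \<subseteq> V"
  using mat_pow_mult_vec_mem[OF assms(1)] assms(2) unfolding krylov_vecs_def by blast

lemma krylov_vecs_invariant: "(*v) D ` krylov_vecs D H G \<subseteq> krylov_vecs D H G"
proof
  fix x assume "x \<in> (*v) D ` krylov_vecs D H G"
  then obtain k c where "c \<in> G" "x = D *v (mat_pow D k *v column c H)"
    unfolding krylov_vecs_def by auto
  then have "c \<in> G" "x = mat_pow D (Suc k) *v column c H" by (simp_all only: mat_pow_Suc_mult_vec)
  then show "x \<in> krylov_vecs D H G" unfolding krylov_vecs_def by blast
qed

lemma span_Un_krylov_vecs_invariant:
  assumes "(*v) D ` X \<subseteq> X"
  shows "(*v) D ` span (X \<union> krylov_vecs D H G) \<subseteq> span (X \<union> krylov_vecs D H G)"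
  using assms krylov_vecs_invariant[of D H G] span_Un_upper1[of X] span_Un_upper2[of _ X]
  by (intro span_invariant) blast

lemma span_Un_krylov_vecs_subset:
  assumes "subspace W" "(*v) D ` W \<subseteq> W" "X \<subseteq> W" "column_set H G \<subseteq> W"
  shows "span (X \<union> krylov_vecs D H G) \<subseteq> W"
  using assms krylov_vecs_subset[OF assms(2,4)] by (simp add: span_minimal)

lemma krylov_vecs_subset_range_Un: "krylov_vecs D H G \<subseteq> range ((*v) D) \<union> column_set H G"
proof
  fix x assume "x \<in> krylov_vecs D H G"
  then obtain k c where x: "c \<in> G" "x = mat_pow D k *v column c H" unfolding krylov_vecs_def by blast
  show "x \<in> range ((*v) D) \<union> column_set H G"
  proof (cases k)
    case 0
    then show ?thesis using x by simp
  next
    case (Suc k')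
    then show ?thesis using x by (simp only: mat_pow_Suc_mult_vec) blast
  qed
qed

lemma krylov_vecs_mult_left: "krylov_vecs D (D ** H) G = (*v) D ` krylov_vecs D H G"
  unfolding krylov_vecs_def column_matrix_mult mat_pow_commute_mult_vec by blast

lemma pattern_vecs_mult_left: "pattern_vecs D (D ** H) T K = (*v) D ` pattern_vecs D H T K"
  unfolding pattern_vecs_def column_matrix_mult mat_pow_commute_mult_vec by blast

lemma pattern_vecs_subset_krylov_vecs:
  assumes "\<And>k. k < K \<Longrightarrow> T k \<subseteq> G"
  shows "pattern_vecs D H T K \<subseteq> krylov_vecs D H G"
  using assms unfolding pattern_vecs_def krylov_vecs_def by blast

lemma pattern_vecs_subset_range_Un:
  "pattern_vecs D H T K \<subseteq> range ((*v) D) \<union> column_set H (T 0)"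
proof
  fix x assume "x \<in> pattern_vecs D H T K"
  then obtain k c where x: "c \<in> T k" "x = mat_pow D k *v column c H"
    unfolding pattern_vecs_def by blast
  show "x \<in> range ((*v) D) \<union> column_set H (T 0)"
  proof (cases k)
    case 0
    then show ?thesis using x by simp
  next
    case (Suc k')
    then show ?thesis using x by (simp only: mat_pow_Suc_mult_vec) blast
  qed
qed

lemma pattern_vecs_mono: "K \<le> K' \<Longrightarrow> pattern_vecs D H T K \<subseteq> pattern_vecs D H T K'"
  unfolding pattern_vecs_def by fastforce

lemma pattern_vecs_one: "pattern_vecs D H T (Suc 0) = column_set H (T 0)"
  unfolding pattern_vecs_def by force

lemma pattern_vecs_append:
  "pattern_vecs D H (\<lambda>k. if k < l then A k else B (k - l)) (l + m)
     = pattern_vecs D H A l \<union> (*v) (mat_pow D l) ` pattern_vecs D H B m"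
  (is "?lhs = ?rhs")
proof
  show "?lhs \<subseteq> ?rhs"
  proof
    fix x assume "x \<in> ?lhs"
    then obtain k c where k: "k < l + m" "c \<in> (if k < l then A k else B (k - l))"
        "x = mat_pow D k *v column c H"
      unfolding pattern_vecs_def by blast
    show "x \<in> ?rhs"
    proof (cases "k < l")
      case True
      then show ?thesis using k unfolding pattern_vecs_def by auto
    next
      case False
      then have "x = mat_pow D l *v (mat_pow D (k - l) *v column c H)"
        using k(3) mat_pow_add_mult_vec[of D l "k - l"] by simp
      moreover have "k - l < m" "c \<in> B (k - l)" using k False by auto
      ultimately show ?thesis unfolding pattern_vecs_def by blast
    qed
  qed
  show "?rhs \<subseteq> ?lhs"
  proof
    fix x assume "x \<in> ?rhs"
    then consider "x \<in> pattern_vecs D H A l"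
      | k c where "k < m" "c \<in> B k" "x = mat_pow D (l + k) *v column c H"
      unfolding pattern_vecs_def mat_pow_add_mult_vec by blast
    then show "x \<in> ?lhs"
    proof cases
      case 1
      then show ?thesis unfolding pattern_vecs_def by fastforce
    next
      case 2
      then show ?thesis unfolding pattern_vecs_def
        by (intro CollectI exI[of _ "l + k"] exI[of _ c]) simp
    qed
  qed
qed

lemma pattern_vecs_const_Suc:
  "pattern_vecs D H (\<lambda>_. G) (Suc K) = column_set H G \<union> (*v) D ` pattern_vecs D H (\<lambda>_. G) K"
  using pattern_vecs_append[of D H 1 "\<lambda>_. G" "\<lambda>_. G" K] by (simp add: pattern_vecs_one)

lemma pattern_vecs_const_eq_UN:
  "pattern_vecs D H (\<lambda>_. G) m = (\<Union>i<m. (*v) (mat_pow D i) ` column_set H G)"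
  unfolding pattern_vecs_def by auto

text \<open>Every repetition of \<open>G\<close> that does not yet reach the Krylov space adds a dimension.\<close>
lemma span_pattern_vecs_const:
  fixes D :: "real^'n^'n" and H :: "real^'l^'n" and G :: "'l set"
  assumes "subspace X" "(*v) D ` X \<subseteq> X"
  defines "W \<equiv> span (X \<union> krylov_vecs D H G)"
  shows "span (X \<union> pattern_vecs D H (\<lambda>_. G) (Suc (dim W - dim (X \<union> column_set H G)))) = W"
proof -
  define Y where "Y j = span (X \<union> pattern_vecs D H (\<lambda>_. G) (Suc j))" for j
  have Y0: "Y 0 = span (X \<union> column_set H G)" unfolding Y_def pattern_vecs_one ..
  have "Y (0 + (dim W - dim (Y 0))) = W"
  proof (rule subspace_chain_reaches)
    show "Y j \<subseteq> Y (Suc j)" for j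
      unfolding Y_def by (intro span_mono Un_mono order_refl pattern_vecs_mono) simp
    show "Y j \<subseteq> W" for j
      unfolding Y_def W_def by (intro span_mono Un_mono order_refl pattern_vecs_subset_krylov_vecs)
    show "subspace (Y j)" for j unfolding Y_def by simp
    show "Y j = W" if stable: "Y (Suc j) = Y j" for j
    proof
      show "Y j \<subseteq> W"
        unfolding Y_def W_def by (intro span_mono Un_mono order_refl pattern_vecs_subset_krylov_vecs)
      have "(*v) D ` Y j = span ((*v) D ` X \<union> (*v) D ` pattern_vecs D H (\<lambda>_. G) (Suc j))"
        unfolding Y_def
          by (simp only: span_linear_image[OF matrix_vector_mul_linear, symmetric] image_Un)
      also have "\<dots> \<subseteq> Y (Suc j)"
        unfolding Y_def pattern_vecs_const_Suc[of D H G "Suc j"] using assms(2)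
          by (intro span_mono) blast
      finally have "(*v) D ` Y j \<subseteq> Y j" unfolding stable .
      moreover have "column_set H G \<subseteq> Y j"
        using span_Un_upper2[of "column_set H G \<union> (*v) D ` pattern_vecs D H (\<lambda>_. G) j" X]
        unfolding Y_def pattern_vecs_const_Suc by (rule le_supE)
      ultimately have "krylov_vecs D H G \<subseteq> Y j" by (rule krylov_vecs_subset)
      moreover have "X \<subseteq> Y j" unfolding Y_def by (rule span_Un_upper1)
      ultimately show "W \<subseteq> Y j" unfolding W_def Y_def by (simp add: span_minimal)
    qed
  qed
  then show ?thesis unfolding Y0 dim_span by (simp add: Y_def)
qed

lemma span_iterate:
  fixes D :: "real^'n^'n"
  assumes "V \<subseteq> span (Y \<union> (*v) D ` V)"
  shows "V \<subseteq> span ((\<Union>i<m. (*v) (mat_pow D i) ` Y) \<union> (*v) (mat_pow D m) ` V)"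
proof (induction m)
  case 0
  show ?case by (simp add: span_superset)
next
  case (Suc m)
  let ?Z = "span ((\<Union>i<Suc m. (*v) (mat_pow D i) ` Y) \<union> (*v) (mat_pow D (Suc m)) ` V)"
  have "(*v) (mat_pow D m) ` V \<subseteq> (*v) (mat_pow D m) ` span (Y \<union> (*v) D ` V)"
    using assms by blast
  also have "\<dots> = span ((*v) (mat_pow D m) ` Y \<union> (*v) (mat_pow D (Suc m)) ` V)"
    by (simp only: span_linear_image[OF matrix_vector_mul_linear, symmetric] image_Un image_mat_pow_Suc)
  also have "\<dots> \<subseteq> ?Z" by (intro span_mono) (auto simp: lessThan_Suc)
  finally have "(*v) (mat_pow D m) ` V \<subseteq> ?Z" .
  moreover have "(\<Union>i<m. (*v) (mat_pow D i) ` Y) \<subseteq> ?Z"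
    using span_Un_upper1 by fastforce
  ultimately have "span ((\<Union>i<m. (*v) (mat_pow D i) ` Y) \<union> (*v) (mat_pow D m) ` V) \<subseteq> ?Z"
    by (simp add: span_minimal)
  with Suc.IH show ?case by blast
qed

section \<open>Trajectories and steerability\<close>

lemma traj_formula:
  "traj D H x0 h K = mat_pow D K *v x0 + (\<Sum>j=1..K. mat_pow D (K - j) *v (H *v h j))"
proof (induction K)
  case (Suc K)
  have "D *v (\<Sum>j=1..K. mat_pow D (K - j) *v (H *v h j))
      = (\<Sum>j=1..K. mat_pow D (Suc K - j) *v (H *v h j))"
    unfolding vec.sum
  proof (rule sum.cong)
    fix j assume "j \<in> {1..K}"
    then have "Suc K - j = Suc (K - j)" by auto
    then show "D *v (mat_pow D (K - j) *v (H *v h j)) = mat_pow D (Suc K - j) *v (H *v h j)"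
      by (simp only: mat_pow_Suc_mult_vec)
  qed simp
  then show ?case
    by (simp add: Suc matrix_vector_right_distrib matrix_vector_mul_assoc add.assoc)
qed simp

lemma traj_affine: "traj D H x0 h K = mat_pow D K *v x0 + traj D H 0 h K"
  unfolding traj_formula[of D H x0] traj_formula[of D H 0] by simp

definition input_pattern :: "nat \<Rightarrow> (nat \<Rightarrow> real^'l) \<Rightarrow> nat \<Rightarrow> 'l set" where
  "input_pattern K h k = (if k < K then {i. h (K - k) $ i \<noteq> 0} else {})"

lemma card_input_pattern_le:
  assumes "\<forall>j\<in>{1..K}. l0 (h j) \<le> s"
  shows "card (input_pattern K h k) \<le> s"
  using assms unfolding input_pattern_def l0_def by (cases "k < K") auto

lemma traj_zero_mem_span_pattern_vecs:
  fixes D :: "real^'n^'n" and H :: "real^'l^'n"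
  shows "traj D H 0 h K \<in> span (pattern_vecs D H (input_pattern K h) K)"
proof -
  have summand: "mat_pow D (K - j) *v (H *v h j) \<in> span (pattern_vecs D H (input_pattern K h) K)"
    if j: "j \<in> {1..K}" for j
  proof -
    have "H *v h j = (\<Sum>i\<in>UNIV. h j $ i *s column i H)" by (rule matrix_mult_sum)
    then have "mat_pow D (K - j) *v (H *v h j) = (\<Sum>i\<in>UNIV. h j $ i *\<^sub>R (mat_pow D (K - j) *v column i H))"
      by (simp only: vec.sum scalar_mult_eq_scaleR matrix_vector_mult_scaleR)
    also have "\<dots> \<in> span (pattern_vecs D H (input_pattern K h) K)"
    proof (intro span_sum)
      fix i
      show "h j $ i *\<^sub>R (mat_pow D (K - j) *v column i H) \<in> span (pattern_vecs D H (input_pattern K h) K)"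
      proof (cases "h j $ i = 0")
        case False
        then have "i \<in> input_pattern K h (K - j)" using j unfolding input_pattern_def by auto
        then have "mat_pow D (K - j) *v column i H \<in> pattern_vecs D H (input_pattern K h) K"
          using j unfolding pattern_vecs_def by fastforce
        then show ?thesis by (intro span_mul span_base)
      qed (simp add: span_zero)
    qed
    finally show ?thesis .
  qed
  have "(\<Sum>j=1..K. mat_pow D (K - j) *v (H *v h j)) \<in> span (pattern_vecs D H (input_pattern K h) K)"
    by (rule span_sum) (rule summand)
  then show ?thesis by (simp add: traj_formula[of D H 0])
qed

lemma span_pattern_vecs_reachable:
  fixes D :: "real^'n^'n" and H :: "real^'l^'n"
  assumes "y \<in> span (pattern_vecs D H T K)"
  shows "\<exists>h. (\<forall>j\<in>{1..K}. {i. h j $ i \<noteq> 0} \<subseteq> T (K - j)) \<and> traj D H 0 h K = y"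
  using assms
proof (induction rule: span_induct_alt)
  case base
  show ?case by (intro exI[of _ "\<lambda>_. 0"]) (simp add: traj_formula)
next
  case (step a g y)
  obtain h where h: "\<forall>j\<in>{1..K}. {i. h j $ i \<noteq> 0} \<subseteq> T (K - j)" "traj D H 0 h K = y"
    using step.IH by blast
  obtain k c where g: "k < K" "c \<in> T k" "g = mat_pow D k *v column c H"
    using step.hyps unfolding pattern_vecs_def by blast
  define h' where "h' j = h j + (if j = K - k then a *\<^sub>R axis c 1 else 0)" for j
  have "(\<Sum>j=1..K. mat_pow D (K - j) *v (H *v (if j = K - k then a *\<^sub>R axis c 1 else 0)))
      = mat_pow D (K - (K - k)) *v (H *v (a *\<^sub>R axis c 1))"
    using g(1) by (simp add: if_distrib[of "\<lambda>u. mat_pow D _ *v (H *v u)"] sum.delta' cong: if_cong)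
  also have "\<dots> = a *\<^sub>R g"
    using g by (simp add: matrix_vector_mult_scaleR matrix_vector_mult_basis)
  finally have "traj D H 0 h' K = a *\<^sub>R g + y"
    unfolding h(2)[symmetric] traj_formula[of D H 0] h'_def
    by (simp add: matrix_vector_right_distrib sum.distrib)
  moreover have "{i. h' j $ i \<noteq> 0} \<subseteq> T (K - j)" if "j \<in> {1..K}" for j
  proof -
    have sub: "{i. h' j $ i \<noteq> 0} \<subseteq> {i. h j $ i \<noteq> 0} \<union> (if j = K - k then {c} else {})"
      unfolding h'_def by (auto simp: axis_def)
    have hj: "{i. h j $ i \<noteq> 0} \<subseteq> T (K - j)" using h(1) that by blast
    show ?thesis
    proof (cases "j = K - k")
      case True
      then have "c \<in> T (K - j)" using g(1,2) by simp
      then show ?thesis using sub hj True by auto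
    qed (use sub hj in auto)
  qed
  ultimately show ?case by blast
qed

lemma steerable_in_if_span_pattern_vecs:
  fixes D :: "real^'n^'n" and H :: "real^'l^'n"
  assumes "\<forall>k. card (T k) \<le> s" "span (pattern_vecs D H T K) = UNIV"
  shows "steerable_in D H s K"
  unfolding steerable_in_def
proof (intro allI)
  fix x0 xf :: "real^'n"
  obtain h where h: "\<forall>j\<in>{1..K}. {i. h j $ i \<noteq> 0} \<subseteq> T (K - j)"
      "traj D H 0 h K = xf - mat_pow D K *v x0"
    using span_pattern_vecs_reachable[of "xf - mat_pow D K *v x0" D H T K] assms(2) by blast
  have "l0 (h j) \<le> s" if "j \<in> {1..K}" for j
    using card_mono[OF _ h(1)[rule_format, OF that]] assms(1) unfolding l0_def
    by (meson finite order_trans)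
  moreover have "traj D H x0 h K = xf" using h(2) traj_affine[of D H x0 h K] by simp
  ultimately show "\<exists>h. (\<forall>k\<in>{1..K}. l0 (h k) \<le> s) \<and> traj D H x0 h K = xf" by blast
qed

lemma span_pattern_vecs_UNIV_if_reachable:
  fixes D :: "real^'n^'n" and H :: "real^'l^'n"
  assumes "\<And>xf. \<exists>K\<in>Ks. \<exists>h. (\<forall>k\<in>{1..K}. l0 (h k) \<le> s) \<and> traj D H 0 h K = xf"
  shows "\<exists>K\<in>Ks. \<exists>T. (\<forall>k. card (T k) \<le> s) \<and> span (pattern_vecs D H T K) = UNIV"
proof -
  define F where "F = {span (pattern_vecs D H T K) | T K. K \<in> Ks \<and> (\<forall>k. card (T k) \<le> s)}"
  have "F \<subseteq> (\<Union>K. (\<lambda>T. span (pattern_vecs D H T K)) ` ({..<K} \<rightarrow>\<^sub>E UNIV))"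
  proof
    fix S assume "S \<in> F"
    then obtain T K where "S = span (pattern_vecs D H T K)" unfolding F_def by blast
    moreover have "pattern_vecs D H T K = pattern_vecs D H (restrict T {..<K}) K"
      unfolding pattern_vecs_def by auto
    ultimately show "S \<in> (\<Union>K. (\<lambda>T. span (pattern_vecs D H T K)) ` ({..<K} \<rightarrow>\<^sub>E UNIV))"
      by (intro UN_I[OF UNIV_I] image_eqI[of _ _ "restrict T {..<K}"]) auto
  qed
  moreover have "countable (\<Union>K. (\<lambda>T. span (pattern_vecs D H T K)) ` ({..<K} \<rightarrow>\<^sub>E UNIV))"
    by (intro countable_UN[OF countableI_type] countable_finite finite_imageI finite_PiE) auto
  ultimately have "countable F" by (rule countable_subset)
  moreover have "\<Union>F = UNIV"
  proof -
    have "xf \<in> \<Union>F" for xf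
    proof -
      obtain K h where K: "K \<in> Ks" and h: "\<forall>k\<in>{1..K}. l0 (h k) \<le> s" "traj D H 0 h K = xf"
        using assms by blast
      have "span (pattern_vecs D H (input_pattern K h) K) \<in> F"
        unfolding F_def using K card_input_pattern_le[OF h(1)] by blast
      moreover have "xf \<in> span (pattern_vecs D H (input_pattern K h) K)"
        using traj_zero_mem_span_pattern_vecs[of D H h K] h(2) by simp
      ultimately show ?thesis by blast
    qed
    then show ?thesis by blast
  qed
  ultimately have "UNIV \<in> F" by (intro countable_subspace_cover) (auto simp: F_def)
  then show ?thesis unfolding F_def by auto
qed

lemma steerable_in_iff_span_pattern_vecs:
  fixes D :: "real^'n^'n" and H :: "real^'l^'n"
  shows
  "steerable_in D H s K \<longleftrightarrow> (\<exists>T. (\<forall>k. card (T k) \<le> s) \<and> span (pattern_vecs D H T K) = UNIV)"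
proof
  assume "steerable_in D H s K"
  then have "\<exists>K'\<in>{K}. \<exists>h. (\<forall>k\<in>{1..K'}. l0 (h k) \<le> s) \<and> traj D H 0 h K' = xf" for xf
    unfolding steerable_in_def by blast
  then show "\<exists>T. (\<forall>k. card (T k) \<le> s) \<and> span (pattern_vecs D H T K) = UNIV"
    using span_pattern_vecs_UNIV_if_reachable[of "{K}" s D H] by blast
qed (use steerable_in_if_span_pattern_vecs in blast)

lemma steerable_in_mono:
  fixes D :: "real^'n^'n" and H :: "real^'l^'n"
  assumes "steerable_in D H s K" "K \<le> K'"
  shows "steerable_in D H s K'"
proof -
  obtain T where T: "\<forall>k. card (T k) \<le> s" "span (pattern_vecs D H T K) = UNIV"
    using assms(1) steerable_in_iff_span_pattern_vecs by blast
  define T' where "T' k = (if k < K then T k else {})" for k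
  have "pattern_vecs D H T' K' = pattern_vecs D H T K"
    using assms(2) unfolding pattern_vecs_def T'_def by (auto split: if_splits)
  moreover have "\<forall>k. card (T' k) \<le> s" using T(1) unfolding T'_def by simp
  ultimately show ?thesis using T(2) steerable_in_if_span_pattern_vecs by metis
qed

lemma sparse_controllable_imp_steerable_in:
  fixes D :: "real^'n^'n" and H :: "real^'l^'n"
  assumes "sparse_controllable D H s"
  shows "steerable_in D H s (Kstar D H s)"
proof -
  have "\<exists>K\<in>UNIV. \<exists>h. (\<forall>k\<in>{1..K}. l0 (h k) \<le> s) \<and> traj D H 0 h K = xf" for xf
    using assms unfolding sparse_controllable_def by blast
  then have "\<exists>K. steerable_in D H s K"
    using span_pattern_vecs_UNIV_if_reachable[of UNIV s D H] steerable_in_if_span_pattern_vecs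
    by blast
  then show ?thesis unfolding Kstar_def by (rule LeastI_ex)
qed

lemma Kstar_le: "steerable_in D H s K \<Longrightarrow> Kstar D H s \<le> K"
  unfolding Kstar_def by (rule Least_le)

section \<open>The lower bound\<close>

lemma rank_eq_dim_column_set: "rank H = dim (column_set H UNIV)" for H :: "real^'l^'n"
  unfolding column_rank_def columns_def by (simp add: full_SetCompr_eq)

lemma dim_pattern_vecs_le:
  fixes D :: "real^'n^'n" and H :: "real^'l^'n"
  assumes "\<forall>k. card (T k) \<le> s"
  shows "dim (pattern_vecs D H T K) \<le> K * Rstar H s"
proof -
  have bound: "dim ((*v) (mat_pow D k) ` column_set H (T k)) \<le> Rstar H s" for k
  proof -
    have "dim ((*v) (mat_pow D k) ` column_set H (T k)) \<le> dim (column_set H (T k))"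
      by (rule dim_image_le[OF matrix_vector_mul_linear])
    moreover have "dim (column_set H (T k)) \<le> card (column_set H (T k))"
      by (rule dim_le_card[OF span_superset]) simp
    moreover have "card (column_set H (T k)) \<le> card (T k)" by (rule card_image_le) simp
    moreover have "dim (column_set H (T k)) \<le> rank H"
      unfolding rank_eq_dim_column_set by (rule dim_subset) blast
    ultimately show ?thesis using spec[OF assms, of k] by (simp add: Rstar_def)
  qed
  have "pattern_vecs D H T K = (\<Union>k<K. (*v) (mat_pow D k) ` column_set H (T k))"
    unfolding pattern_vecs_def by auto
  then have "dim (pattern_vecs D H T K) \<le> (\<Sum>k<K. dim ((*v) (mat_pow D k) ` column_set H (T k)))"
    by (simp only: dim_UN_lessThan_le)
  also have "\<dots> \<le> (\<Sum>k<K. Rstar H s)" by (rule sum_mono) (rule bound)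
  also have "\<dots> = K * Rstar H s" by simp
  finally show ?thesis .
qed

lemma card_le_mult_Rstar:
  fixes D :: "real^'n^'n" and H :: "real^'l^'n"
  assumes "steerable_in D H s K"
  shows "CARD('n) \<le> K * Rstar H s"
proof -
  obtain T where "\<forall>k. card (T k) \<le> s" "span (pattern_vecs D H T K) = UNIV"
    using assms steerable_in_iff_span_pattern_vecs by blast
  then show ?thesis using dim_pattern_vecs_le[of T s D H K] dim_span[of "pattern_vecs D H T K"] by simp
qed

section \<open>The upper bound via the rank of \<open>H\<close>\<close>

lemma span_pattern_vecs_prepend:
  fixes D :: "real^'n^'n"
  assumes "V \<subseteq> span (X \<union> (*v) D ` V \<union> column_set H S)"
    and "span (X \<union> (*v) D ` V) \<subseteq> span (X \<union> pattern_vecs D (D ** H) T K)"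
  shows "V \<subseteq> span (X \<union> pattern_vecs D H (\<lambda>k. if k < 1 then S else T (k - 1)) (1 + K))"
proof -
  let ?W = "span (X \<union> pattern_vecs D H (\<lambda>k. if k < 1 then S else T (k - 1)) (1 + K))"
  have pattern: "pattern_vecs D H (\<lambda>k. if k < 1 then S else T (k - 1)) (1 + K)
      = column_set H S \<union> pattern_vecs D (D ** H) T K"
    using pattern_vecs_append[of D H 1 "\<lambda>_. S" T K] pattern_vecs_one[of D H "\<lambda>_. S"]
    by (simp add: pattern_vecs_mult_left)
  have "span (X \<union> pattern_vecs D (D ** H) T K) \<subseteq> ?W"
    unfolding pattern by (rule span_mono) blast
  then have "X \<union> (*v) D ` V \<subseteq> ?W"
    using span_superset[of "X \<union> (*v) D ` V"] assms(2) by (meson subset_trans)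
  moreover have "column_set H S \<subseteq> ?W"
    unfolding pattern using span_superset[of "X \<union> (column_set H S \<union> pattern_vecs D (D ** H) T K)"]
    by blast
  ultimately have "span (X \<union> (*v) D ` V \<union> column_set H S) \<subseteq> ?W"
    by (simp add: span_minimal)
  with assms(1) show ?thesis by (rule subset_trans)
qed

lemma span_pattern_vecs_after_krylov:
  fixes D :: "real^'n^'n"
  assumes X: "(*v) D ` X \<subseteq> X" and V: "V \<subseteq> span (X \<union> (*v) D ` V)"
    and X': "X' = span (X \<union> pattern_vecs D H (\<lambda>_. G) l)" "(*v) D ` X' \<subseteq> X'"
    and VX': "V \<subseteq> span (X' \<union> pattern_vecs D H T K)"
  shows "V \<subseteq> span (X \<union> pattern_vecs D H (\<lambda>k. if k < l then G else T (k - l)) (l + K))"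
proof -
  let ?W = "span (X \<union> pattern_vecs D H (\<lambda>k. if k < l then G else T (k - l)) (l + K))"
  have pattern: "pattern_vecs D H (\<lambda>k. if k < l then G else T (k - l)) (l + K)
      = pattern_vecs D H (\<lambda>_. G) l \<union> (*v) (mat_pow D l) ` pattern_vecs D H T K"
    using pattern_vecs_append[of D H l "\<lambda>_. G" T K] by simp
  have XW: "X \<subseteq> ?W" by (rule span_Un_upper1)
  have X'W: "X' \<subseteq> ?W" unfolding X'(1) pattern by (rule span_mono) blast
  have "(*v) (mat_pow D l) ` V \<subseteq> (*v) (mat_pow D l) ` span (X' \<union> pattern_vecs D H T K)"
    using VX' by (rule image_mono)
  also have "\<dots> = span ((*v) (mat_pow D l) ` X' \<union> (*v) (mat_pow D l) ` pattern_vecs D H T K)"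
    by (simp add: span_linear_image[OF matrix_vector_mul_linear, symmetric] image_Un)
  also have "\<dots> \<subseteq> ?W"
  proof (rule span_minimal)
    have "(*v) (mat_pow D l) ` X' \<subseteq> X'" using mat_pow_mult_vec_mem[OF X'(2)] by blast
    then have "(*v) (mat_pow D l) ` X' \<subseteq> ?W" using X'W by (rule subset_trans)
    moreover have "(*v) (mat_pow D l) ` pattern_vecs D H T K \<subseteq> ?W"
      unfolding pattern
      using span_Un_upper2[of "pattern_vecs D H (\<lambda>_. G) l \<union> (*v) (mat_pow D l) ` pattern_vecs D H T K" X]
      by blast
    ultimately show "(*v) (mat_pow D l) ` X' \<union> (*v) (mat_pow D l) ` pattern_vecs D H T K \<subseteq> ?W"
      by (rule Un_least)
  qed simp
  finally have "(*v) (mat_pow D l) ` V \<subseteq> ?W" .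
  moreover have "(\<Union>i<l. (*v) (mat_pow D i) ` X) \<subseteq> X"
    using mat_pow_mult_vec_mem[OF X] by blast
  ultimately have "span ((\<Union>i<l. (*v) (mat_pow D i) ` X) \<union> (*v) (mat_pow D l) ` V) \<subseteq> ?W"
    using XW by (simp add: span_minimal)
  with span_iterate[OF V, of l] show ?thesis by (rule subset_trans)
qed

lemma span_Un_krylov_vecs_UNIV:
  fixes D :: "real^'n^'n"
  assumes "(*v) D ` X \<subseteq> X" "V = span (X \<union> krylov_vecs D H UNIV)"
  shows "subspace V" "(*v) D ` V \<subseteq> V" "X \<subseteq> V" "column_set H UNIV \<subseteq> V"
  using assms(2) span_Un_krylov_vecs_invariant[OF assms(1), of H UNIV]
    span_Un_upper1[of X "krylov_vecs D H UNIV"]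
    column_set_subset_krylov_vecs[of H UNIV D] span_Un_upper2[of "krylov_vecs D H UNIV" X]
  by auto

text \<open>A sparse pattern spanning \<open>V\<close> modulo \<open>X\<close> whose length is bounded as in the theorem, with
  \<open>min (rank H) s\<close> replaced by the number of dimensions (at most \<open>s\<close>) that the columns of \<open>H\<close> add
  to \<open>X\<close>.\<close>
definition short_sparse_pattern ::
    "nat \<Rightarrow> real^'n^'n \<Rightarrow> real^'l^'n \<Rightarrow> (real^'n) set \<Rightarrow> (real^'n) set \<Rightarrow> bool" where
  "short_sparse_pattern s D H X V \<longleftrightarrow> (\<exists>T K. (\<forall>k. card (T k) \<le> s)
     \<and> K + min (dim (X \<union> column_set H UNIV) - dim X) s \<le> dim V - dim X + 1
     \<and> V \<subseteq> span (X \<union> pattern_vecs D H T K))"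

lemma short_sparse_pattern_few_columns:
  fixes D :: "real^'n^'n" and H :: "real^'l^'n"
  assumes X: "subspace X" "(*v) D ` X \<subseteq> X" and V: "V = span (X \<union> krylov_vecs D H UNIV)"
    and few: "dim (X \<union> column_set H UNIV) - dim X \<le> s"
  shows "short_sparse_pattern s D H X V"
proof -
  note V_props = span_Un_krylov_vecs_UNIV[OF X(2) V]
  define r where "r = dim (X \<union> column_set H UNIV) - dim X"
  have dims: "dim X \<le> dim (X \<union> column_set H UNIV)" "dim (X \<union> column_set H UNIV) \<le> dim V"
    using V_props(3,4) by (auto intro: dim_subset)
  obtain G where G: "card G = r" "span (X \<union> column_set H G) = span (X \<union> column_set H UNIV)"
    using exists_subset_span_eq[of UNIV X "\<lambda>c. column c H"] unfolding r_def by auto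
  have "span (X \<union> krylov_vecs D H G) = V"
  proof
    show "span (X \<union> krylov_vecs D H G) \<subseteq> V"
      unfolding V by (intro span_mono Un_mono order_refl krylov_vecs_mono) simp
    have "span (X \<union> column_set H G) \<subseteq> span (X \<union> krylov_vecs D H G)"
      by (intro span_mono Un_mono order_refl column_set_subset_krylov_vecs)
    then have "column_set H UNIV \<subseteq> span (X \<union> krylov_vecs D H G)"
      using span_Un_upper2[of "column_set H UNIV" X] G(2) by blast
    then show "V \<subseteq> span (X \<union> krylov_vecs D H G)"
      unfolding V
      by (rule span_Un_krylov_vecs_subset[OF subspace_span span_Un_krylov_vecs_invariant[OF X(2)]
            span_Un_upper1])
  qed
  moreover have "dim (X \<union> column_set H G) = dim X + r"
    using span_eq_dim[OF G(2)] dims unfolding r_def by simp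
  ultimately have "span (X \<union> pattern_vecs D H (\<lambda>_. G) (Suc (dim V - (dim X + r)))) = V"
    using span_pattern_vecs_const[OF X, of H G] by simp
  moreover have "min (dim (X \<union> column_set H UNIV) - dim X) s = r" using few r_def by simp
  ultimately show ?thesis
    unfolding short_sparse_pattern_def using G(1) few dims r_def
    by (intro exI[of _ "\<lambda>_. G"] exI[of _ "Suc (dim V - (dim X + r))"] conjI) auto
qed

lemma subproblem_after_first_step:
  fixes D :: "real^'n^'n" and H :: "real^'l^'n"
  assumes X: "(*v) D ` X \<subseteq> X" and V: "V = span (X \<union> krylov_vecs D H UNIV)"
    and S: "V \<subseteq> span (X \<union> (*v) D ` V \<union> column_set H S)" and proper: "\<not> V \<subseteq> span (X \<union> (*v) D ` V)"
  defines "V' \<equiv> span (X \<union> (*v) D ` V)"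
  shows "V' = span (X \<union> krylov_vecs D (D ** H) UNIV)"
    and "V' \<subseteq> span (X \<union> (*v) D ` V' \<union> column_set (D ** H) S)"
    and "dim X \<le> dim V'" "dim V' < dim V"
proof -
  note V_props = span_Un_krylov_vecs_UNIV[OF X V]
  show "V' = span (X \<union> krylov_vecs D (D ** H) UNIV)"
    unfolding V'_def V krylov_vecs_mult_left by (rule span_Un_image_span[OF matrix_vector_mul_linear X])
  have "(*v) D ` column_set H S = column_set (D ** H) S" by (simp add: image_image column_matrix_mult)
  then show "V' \<subseteq> span (X \<union> (*v) D ` V' \<union> column_set (D ** H) S)"
    using span_Un_image_shift[OF matrix_vector_mul_linear X S] unfolding V'_def by simp
  show "dim X \<le> dim V'" unfolding V'_def by (rule dim_subset[OF span_Un_upper1])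
  have "V' \<subseteq> V" unfolding V'_def using V_props by (intro span_minimal) auto
  moreover have "V' \<noteq> V" using proper unfolding V'_def by blast
  ultimately show "dim V' < dim V"
    using subspace_dim_equal[of V' V] V_props(1) unfolding V'_def by (meson not_le subspace_span)
qed

lemma short_sparse_pattern_shift:
  fixes D :: "real^'n^'n" and H :: "real^'l^'n"
  assumes X: "subspace X" "(*v) D ` X \<subseteq> X" and V: "V = span (X \<union> krylov_vecs D H UNIV)"
    and many: "s < dim (X \<union> column_set H UNIV) - dim X"
    and S: "card S \<le> s" "V \<subseteq> span (X \<union> (*v) D ` V \<union> column_set H S)"
    and dims: "dim X \<le> dim (span (X \<union> (*v) D ` V))" "dim (span (X \<union> (*v) D ` V)) < dim V"
    and shifted: "short_sparse_pattern s D (D ** H) X (span (X \<union> (*v) D ` V))"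
  shows "short_sparse_pattern s D H X V"
proof -
  note V_props = span_Un_krylov_vecs_UNIV[OF X(2) V]
  obtain T K where T: "\<forall>k. card (T k) \<le> s"
      "K + min (dim (X \<union> column_set (D ** H) UNIV) - dim X) s \<le> dim (span (X \<union> (*v) D ` V)) - dim X + 1"
      "span (X \<union> (*v) D ` V) \<subseteq> span (X \<union> pattern_vecs D (D ** H) T K)"
    using shifted unfolding short_sparse_pattern_def by blast
  have "dim (X \<union> (*v) D ` V) + dim (span (X \<union> column_set H UNIV))
      \<le> dim (X \<union> (*v) D ` span (X \<union> column_set H UNIV)) + dim V"
    using span_minimal[of "X \<union> column_set H UNIV" V] V_props
    by (intro dim_Un_linear_image_le[OF matrix_vector_mul_linear]) auto
  moreover have "dim (X \<union> (*v) D ` span (X \<union> column_set H UNIV)) = dim (X \<union> column_set (D ** H) UNIV)"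
    using span_eq_dim[OF span_Un_image_span[OF matrix_vector_mul_linear X(2)]]
    by (simp add: image_image column_matrix_mult)
  moreover have "dim X \<le> dim (X \<union> column_set H UNIV)" by (rule dim_subset[OF Un_upper1])
  ultimately have ineq: "dim (span (X \<union> (*v) D ` V)) + (dim (X \<union> column_set H UNIV) - dim X)
      \<le> dim (X \<union> column_set (D ** H) UNIV) + dim V - dim X"
    by simp
  have "dim X \<le> dim (X \<union> column_set (D ** H) UNIV)" by (rule dim_subset[OF Un_upper1])
  moreover have "K + (dim (X \<union> column_set (D ** H) UNIV) - dim X) \<le> dim (span (X \<union> (*v) D ` V)) - dim X + 1
      \<or> K + s \<le> dim (span (X \<union> (*v) D ` V)) - dim X + 1"
    using T(2) by (auto simp: min_def split: if_splits)
  ultimately have "1 + K + min (dim (X \<union> column_set H UNIV) - dim X) s \<le> dim V - dim X + 1"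
    using ineq dims many by auto
  moreover have "V \<subseteq> span (X \<union> pattern_vecs D H (\<lambda>k. if k < 1 then S else T (k - 1)) (1 + K))"
    using S(2) T(3) by (rule span_pattern_vecs_prepend)
  moreover have "\<forall>k. card (if k < 1 then S else T (k - 1)) \<le> s" using S(1) T(1) by simp
  ultimately show ?thesis
    unfolding short_sparse_pattern_def
    by (intro exI[of _ "\<lambda>k. if k < 1 then S else T (k - 1)"] exI[of _ "1 + K"] conjI) (assumption+)
qed

lemma dim_less_Un_column_set:
  fixes D :: "real^'n^'n" and H :: "real^'l^'n"
  assumes "subspace X'" "(*v) D ` X' \<subseteq> X'" "X \<subseteq> X'"
    and "X' \<subset> span (X \<union> krylov_vecs D H UNIV)"
  shows "dim X' < dim (X' \<union> column_set H UNIV)"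
proof -
  have "\<not> column_set H UNIV \<subseteq> X'"
    using span_Un_krylov_vecs_subset[OF assms(1-3)] assms(4) by blast
  then obtain c where "column c H \<notin> span X'" using span_eq_iff[THEN iffD2, OF assms(1)] by auto
  then show ?thesis
    using dim_insert[of "column c H" X'] dim_subset[of "insert (column c H) X'" "X' \<union> column_set H UNIV"]
    by auto
qed

lemma short_sparse_pattern_saturate:
  fixes D :: "real^'n^'n" and H :: "real^'l^'n"
  assumes s: "0 < s" and X: "subspace X" "(*v) D ` X \<subseteq> X" and V: "V = span (X \<union> krylov_vecs D H UNIV)"
    and many: "s < dim (X \<union> column_set H UNIV) - dim X" and DV: "V \<subseteq> span (X \<union> (*v) D ` V)"
    and larger: "\<And>X'. subspace X' \<Longrightarrow> (*v) D ` X' \<subseteq> X' \<Longrightarrow> X \<subseteq> X' \<Longrightarrow> X' \<subseteq> V \<Longrightarrow> dim X < dim X'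
      \<Longrightarrow> short_sparse_pattern s D H X' V"
  shows "short_sparse_pattern s D H X V"
proof -
  note V_props = span_Un_krylov_vecs_UNIV[OF X(2) V]
  obtain G where G: "card G = s" "dim (X \<union> column_set H G) = dim X + s"
    using exists_subset_dim_add[of UNIV s X "\<lambda>c. column c H"] many by auto
  define X' where "X' = span (X \<union> krylov_vecs D H G)"
  have X': "subspace X'" "(*v) D ` X' \<subseteq> X'"
    unfolding X'_def by (simp_all add: span_Un_krylov_vecs_invariant[OF X(2)])
  have XX': "X \<subseteq> X'" unfolding X'_def by (rule span_Un_upper1)
  have X'V: "X' \<subseteq> V" unfolding X'_def V by (intro span_mono Un_mono order_refl krylov_vecs_mono) simp
  define l where "l = Suc (dim X' - dim (X \<union> column_set H G))"
  have X'_pattern: "span (X \<union> pattern_vecs D H (\<lambda>_. G) l) = X'"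
    unfolding l_def X'_def by (rule span_pattern_vecs_const[OF X])
  have "X \<union> column_set H G \<subseteq> X'"
    using XX' column_set_subset_krylov_vecs[of H G D] span_Un_upper2[of "krylov_vecs D H G" X]
    unfolding X'_def by blast
  then have dimX': "dim X + s \<le> dim X'" using G(2) dim_subset by metis
  have "dim X' \<le> dim V" using X'V by (rule dim_subset)
  have min_s: "min (dim (X \<union> column_set H UNIV) - dim X) s = s" using many by simp
  show ?thesis
  proof (cases "X' = V")
    case True
    then show ?thesis
      unfolding short_sparse_pattern_def min_s using G(1) X'_pattern dimX'
      by (intro exI[of _ "\<lambda>_. G"] exI[of _ l] conjI) (auto simp: l_def G(2))
  next
    case False
    obtain T K where T: "\<forall>k. card (T k) \<le> s"
        "K + min (dim (X' \<union> column_set H UNIV) - dim X') s \<le> dim V - dim X' + 1"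
        "V \<subseteq> span (X' \<union> pattern_vecs D H T K)"
      using larger[OF X' XX' X'V] dimX' s unfolding short_sparse_pattern_def by auto
    have "dim X' < dim (X' \<union> column_set H UNIV)"
      using X'V False by (intro dim_less_Un_column_set[OF X' XX']) (simp add: V[symmetric])
    then have "K \<le> dim V - dim X'" using T(2) s by (simp add: min_def split: if_splits)
    then have "l + K + min (dim (X \<union> column_set H UNIV) - dim X) s \<le> dim V - dim X + 1"
      using dimX' \<open>dim X' \<le> dim V\<close> unfolding min_s l_def G(2) by arith
    moreover have "V \<subseteq> span (X \<union> pattern_vecs D H (\<lambda>k. if k < l then G else T (k - l)) (l + K))"
      using X(2) DV X'_pattern[symmetric] X'(2) T(3) by (rule span_pattern_vecs_after_krylov)
    moreover have "\<forall>k. card (if k < l then G else T (k - l)) \<le> s" using G(1) T(1) by simp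
    ultimately show ?thesis
      unfolding short_sparse_pattern_def
      by (intro exI[of _ "\<lambda>k. if k < l then G else T (k - l)"] exI[of _ "l + K"] conjI) (assumption+)
  qed
qed

text \<open>If the columns of \<open>H\<close> add at most \<open>s\<close> dimensions modulo \<open>X\<close>, they are repeated until their
  Krylov space is reached. If \<open>X + D V\<close> is a proper subspace of \<open>V\<close>, the first step supplies the
  missing columns \<open>S\<close> and the remaining steps solve the problem for \<open>X + D V\<close> and \<open>D H\<close>.
  Otherwise \<open>s\<close> new columns are repeated until their Krylov space is reached, and this space is
  added to \<open>X\<close>.\<close>
lemma short_sparse_pattern_exists:
  fixes D :: "real^'n^'n" and H :: "real^'l^'n"
  assumes "0 < s" "subspace X" "(*v) D ` X \<subseteq> X" "V = span (X \<union> krylov_vecs D H UNIV)"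
    and "card S \<le> s" "V \<subseteq> span (X \<union> (*v) D ` V \<union> column_set H S)"
  shows "short_sparse_pattern s D H X V"
  using assms(2-)
proof (induction "dim V - dim X" arbitrary: V X H S rule: less_induct)
  case less
  note X = less.prems(1,2) and V = less.prems(3) and S = less.prems(4,5)
  consider "dim (X \<union> column_set H UNIV) - dim X \<le> s"
    | "s < dim (X \<union> column_set H UNIV) - dim X" "\<not> V \<subseteq> span (X \<union> (*v) D ` V)"
    | "s < dim (X \<union> column_set H UNIV) - dim X" "V \<subseteq> span (X \<union> (*v) D ` V)"
    by linarith
  then show ?case
  proof cases
    case 1
    then show ?thesis by (rule short_sparse_pattern_few_columns[OF X V])
  next
    case 2
    note sub = subproblem_after_first_step[OF X(2) V S(2) 2(2)]
    have "dim (span (X \<union> (*v) D ` V)) - dim X < dim V - dim X" using sub(3,4) by linarith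
    then show ?thesis
      using short_sparse_pattern_shift[OF X V 2(1) S sub(3,4)] less.hyps[OF _ X sub(1) S(1) sub(2)]
      by blast
  next
    case 3
    have "short_sparse_pattern s D H X' V"
      if X': "subspace X'" "(*v) D ` X' \<subseteq> X'" "X \<subseteq> X'" "X' \<subseteq> V" "dim X < dim X'" for X'
    proof -
      note V_props = span_Un_krylov_vecs_UNIV[OF X(2) V]
      have "V \<subseteq> span (X' \<union> krylov_vecs D H UNIV)" unfolding V using X'(3) by (intro span_mono) blast
      moreover have "krylov_vecs D H UNIV \<subseteq> V" using V span_Un_upper2 by blast
      then have "span (X' \<union> krylov_vecs D H UNIV) \<subseteq> V" using X'(4) V_props(1)
        by (intro span_minimal) auto
      ultimately have V': "V = span (X' \<union> krylov_vecs D H UNIV)" by (rule antisym)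
      have DV': "V \<subseteq> span (X' \<union> (*v) D ` V \<union> column_set H {})"
        using 3(2) X'(3) span_mono[of "X \<union> (*v) D ` V" "X' \<union> (*v) D ` V \<union> column_set H {}"] by blast
      have "dim X' \<le> dim V" using X'(4) by (rule dim_subset)
      then have "dim V - dim X' < dim V - dim X" using X'(5) by (intro diff_less_mono2) simp_all
      moreover have "card ({} :: 'l set) \<le> s" by simp
      ultimately show ?thesis by (rule less.hyps[OF _ X'(1,2) V' _ DV'])
    qed
    then show ?thesis using short_sparse_pattern_saturate[OF assms(1) X V 3] by blast
  qed
qed

lemma steerable_in_card_minus_Rstar:
  fixes D :: "real^'n^'n" and H :: "real^'l^'n"
  assumes "0 < s" "steerable_in D H s K"
  shows "steerable_in D H s (CARD('n) + 1 - Rstar H s)"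
proof -
  obtain T where T: "\<forall>k. card (T k) \<le> s" "span (pattern_vecs D H T K) = UNIV"
    using assms(2) steerable_in_iff_span_pattern_vecs by blast
  have "span (pattern_vecs D H T K) \<subseteq> span ({0} \<union> krylov_vecs D H UNIV)"
    using pattern_vecs_subset_krylov_vecs[of K T UNIV D H] by (intro span_mono) blast
  then have UNIV_krylov: "UNIV = span ({0} \<union> krylov_vecs D H UNIV)" using T(2) by blast
  have "span (pattern_vecs D H T K) \<subseteq> span ({0} \<union> (*v) D ` UNIV \<union> column_set H (T 0))"
    using pattern_vecs_subset_range_Un[of D H T K] by (intro span_mono) blast
  then have "UNIV \<subseteq> span ({0} \<union> (*v) D ` UNIV \<union> column_set H (T 0))" using T(2) by simp
  then obtain T' K' where T': "\<forall>k. card (T' k) \<le> s"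
      "K' + min (dim ({0} \<union> column_set H UNIV) - dim {0::real^'n}) s
         \<le> dim (UNIV :: (real^'n) set) - dim {0::real^'n} + 1"
      "UNIV \<subseteq> span ({0} \<union> pattern_vecs D H T' K')"
    using short_sparse_pattern_exists[OF assms(1) subspace_single_0 _ UNIV_krylov spec[OF T(1), of 0]]
    unfolding short_sparse_pattern_def by simp blast
  have "dim ({0} \<union> column_set H UNIV) = rank H"
    unfolding rank_eq_dim_column_set using span_insert_0[of "column_set H UNIV"]
    by (metis dim_span insert_is_Un)
  then have "K' \<le> CARD('n) + 1 - Rstar H s" using T'(2) unfolding Rstar_def by simp
  moreover have "span (pattern_vecs D H T' K') = UNIV"
    using T'(3) span_insert_0[of "pattern_vecs D H T' K'"] by auto
  ultimately show ?thesis using steerable_in_if_span_pattern_vecs[OF T'(1)] steerable_in_mono by blast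
qed

lemma Kstar_add_Rstar_le:
  fixes D :: "real^'n^'n" and H :: "real^'l^'n"
  assumes "0 < s" "sparse_controllable D H s"
  shows "Kstar D H s + Rstar H s \<le> CARD('n) + 1"
proof -
  have "Kstar D H s \<le> CARD('n) + 1 - Rstar H s"
    using steerable_in_card_minus_Rstar[OF assms(1) sparse_controllable_imp_steerable_in[OF assms(2)]]
    by (rule Kstar_le)
  moreover have "Rstar H s \<le> CARD('n)" using rank_bound[of H] by (simp add: Rstar_def min_le_iff_disj)
  ultimately show ?thesis by arith
qed

section \<open>The upper bound via the minimal polynomial\<close>

lemma exists_blocks:
  assumes "finite S" "G0 \<subseteq> S" "card G0 \<le> s" "card S \<le> g * s" "0 < g"
  shows "\<exists>B. (\<forall>l. card (B l) \<le> s) \<and> G0 \<subseteq> B 0 \<and> S \<subseteq> (\<Union>l<g. B l)"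
  using assms(1,2,4,5)
proof (induction g arbitrary: S)
  case (Suc g)
  show ?case
  proof (cases "g = 0")
    case True
    then show ?thesis using Suc.prems by (intro exI[of _ "\<lambda>_. S"]) auto
  next
    case g: False
    show ?thesis
    proof (cases "card S \<le> g * s")
      case True
      then obtain B where "\<forall>l. card (B l) \<le> s" "G0 \<subseteq> B 0" "S \<subseteq> (\<Union>l<g. B l)"
        using Suc.IH[of S] Suc.prems g by auto
      then show ?thesis by (intro exI[of _ B]) (auto simp: lessThan_Suc)
    next
      case False
      have "s \<le> g * s" using g by (cases g) simp_all
      then have "card G0 \<le> g * s" using assms(3) by (rule le_trans[rotated])
      moreover have "card (S - G0) = card S - card G0"
        using card_Diff_subset[OF finite_subset[OF Suc.prems(2,1)] Suc.prems(2)] .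
      ultimately have "card S - g * s \<le> card (S - G0)" by simp
      then obtain C where C: "C \<subseteq> S - G0" "card C = card S - g * s"
        by (meson obtain_subset_with_card_n)
      have "card (S - C) = g * s"
        using C False Suc.prems(1) card_Diff_subset[of C S] finite_subset[of C S] by auto
      then obtain B where B: "\<forall>l. card (B l) \<le> s" "G0 \<subseteq> B 0" "S - C \<subseteq> (\<Union>l<g. B l)"
        using Suc.IH[of "S - C"] Suc.prems(1,2) C(1) g by auto
      have "card C \<le> s" using C(2) Suc.prems(3) by simp
      then show ?thesis
        using B C(1) g by (intro exI[of _ "B(g := C)"]) (auto simp: lessThan_Suc)
    qed
  qed
qed simp

text \<open>Block \<open>l\<close> is used in the steps \<open>l q, ..., l q + q - 1\<close>, and an annihilating polynomial of
  degree \<open>q\<close> expresses all higher powers of \<open>D\<close> through these.\<close>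
lemma block_powers_in_span_pattern_vecs:
  fixes D :: "real^'n^'n" and H :: "real^'l^'n"
  assumes p: "lead_coeff p = 1" "poly_mat p D = 0" and "l < g" "c \<in> B l"
  shows "mat_pow D (l * degree p) *v (mat_pow D j *v column c H)
    \<in> span (pattern_vecs D H (\<lambda>k. B (k div degree p)) (degree p * g))"
proof -
  define q where "q = degree p"
  define P where "P = span (pattern_vecs D H (\<lambda>k. B (k div q)) (q * g))"
  have "0 < q" unfolding q_def by (rule degree_annihilating_poly_pos[OF p])
  have "(*v) (mat_pow D (l * q)) ` (\<lambda>i. mat_pow D i *v column c H) ` {..<q} \<subseteq> P"
  proof
    fix x assume "x \<in> (*v) (mat_pow D (l * q)) ` (\<lambda>i. mat_pow D i *v column c H) ` {..<q}"
    then obtain i where i: "i < q" "x = mat_pow D (l * q + i) *v column c H"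
      by (auto simp: mat_pow_add_mult_vec)
    have "l * q + i < Suc l * q" using i(1) by simp
    also have "\<dots> \<le> g * q" using assms(3) by (intro mult_right_mono) auto
    finally have "l * q + i < q * g" by (simp add: mult.commute)
    moreover have "(l * q + i) div q = l" using i(1) by simp
    ultimately have "x \<in> pattern_vecs D H (\<lambda>k. B (k div q)) (q * g)"
      unfolding pattern_vecs_def using i(2) assms(4)
      by (intro CollectI exI[of _ "l * q + i"] exI[of _ c]) simp
    then show "x \<in> P" unfolding P_def by (rule span_base)
  qed
  then have "span ((*v) (mat_pow D (l * q)) ` (\<lambda>i. mat_pow D i *v column c H) ` {..<q}) \<subseteq> P"
    unfolding P_def by (simp add: span_minimal)
  moreover have "mat_pow D j *v column c H \<in> span ((\<lambda>i. mat_pow D i *v column c H) ` {..<q})"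
    unfolding q_def by (rule mat_pow_mult_vec_in_span_lower_powers[OF p])
  ultimately show ?thesis
    using span_linear_image[OF matrix_vector_mul_linear, of "mat_pow D (l * q)"
        "(\<lambda>i. mat_pow D i *v column c H) ` {..<q}"]
    unfolding P_def q_def by blast
qed

text \<open>The block containing \<open>G0\<close> covers a complement of the range of \<open>D\<close>, and by the Krylov
  condition all blocks together cover the range of \<open>D^(q g)\<close>.\<close>
lemma steerable_in_blocks:
  fixes D :: "real^'n^'n" and H :: "real^'l^'n"
  assumes kalman: "span (krylov_vecs D H S) = UNIV"
    and G0: "G0 \<subseteq> S" "card G0 \<le> s" "span (column_set H G0 \<union> (*v) D ` UNIV) = UNIV"
    and p: "lead_coeff p = 1" "poly_mat p D = 0"
    and g: "card S \<le> g * s" "0 < g"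
  shows "steerable_in D H s (degree p * g)"
proof -
  define q where "q = degree p"
  obtain B where B: "\<forall>l. card (B l) \<le> s" "G0 \<subseteq> B 0" "S \<subseteq> (\<Union>l<g. B l)"
    using exists_blocks[OF _ G0(1,2) g] by auto
  define P where "P = span (pattern_vecs D H (\<lambda>k. B (k div q)) (q * g))"
  note block = block_powers_in_span_pattern_vecs[OF p, where g = g and B = B and H = H,
      folded q_def, folded P_def]
  have "pattern_vecs D H (\<lambda>_. G0) (q * g) \<subseteq> P"
  proof
    fix x assume "x \<in> pattern_vecs D H (\<lambda>_. G0) (q * g)"
    then obtain i c where "c \<in> G0" "x = mat_pow D (0 * q) *v (mat_pow D i *v column c H)"
      unfolding pattern_vecs_def by auto
    then show "x \<in> P" using block[of 0 c i] B(2) g(2) by auto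
  qed
  moreover have "(*v) (mat_pow D (q * g)) ` krylov_vecs D H S \<subseteq> P"
  proof
    fix x assume "x \<in> (*v) (mat_pow D (q * g)) ` krylov_vecs D H S"
    then obtain j c where jc: "c \<in> S" "x = mat_pow D (q * g) *v (mat_pow D j *v column c H)"
      unfolding krylov_vecs_def by blast
    obtain l where l: "l < g" "c \<in> B l" using B(3) jc(1) by blast
    have "q * g = l * q + (q * g - l * q)" using l(1) by (simp add: mult.commute)
    then have "x = mat_pow D (l * q) *v (mat_pow D (q * g - l * q + j) *v column c H)"
      using jc(2) by (metis mat_pow_add_mult_vec add.assoc)
    then show "x \<in> P" using block[OF l] by simp
  qed
  then have "range ((*v) (mat_pow D (q * g))) \<subseteq> P"
    using kalman
      span_linear_image[OF matrix_vector_mul_linear, of "mat_pow D (q * g)" "krylov_vecs D H S"]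
    unfolding P_def by (metis span_minimal subspace_span)
  ultimately have covered:
      "span (pattern_vecs D H (\<lambda>_. G0) (q * g) \<union> range ((*v) (mat_pow D (q * g)))) \<subseteq> P"
    unfolding P_def by (intro span_minimal) auto
  have "UNIV \<subseteq> span (column_set H G0 \<union> (*v) D ` UNIV)" using G0(3) by simp
  then have "UNIV \<subseteq> span (pattern_vecs D H (\<lambda>_. G0) (q * g) \<union> range ((*v) (mat_pow D (q * g))))"
    unfolding pattern_vecs_const_eq_UN by (rule span_iterate)
  with covered have "span (pattern_vecs D H (\<lambda>k. B (k div q)) (q * g)) = UNIV" unfolding P_def by blast
  then show ?thesis
    using steerable_in_if_span_pattern_vecs[of "\<lambda>k. B (k div q)" s D H "q * g"] B(1) unfolding q_def
    by simp
qed

definition cmat :: "real^'m^'n \<Rightarrow> complex^'m^'n" where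
  "cmat A = (\<chi> i j. complex_of_real (A $ i $ j))"

definition pairing :: "complex^'n \<Rightarrow> real^'n \<Rightarrow> complex" where
  "pairing w x = (\<Sum>i\<in>UNIV. w $ i * complex_of_real (x $ i))"

lemma pairing_matrix_vector_mult: "pairing w (A *v x) = pairing (w v* cmat A) x"
proof -
  have "pairing w (A *v x)
      = (\<Sum>i\<in>UNIV. \<Sum>j\<in>UNIV. w $ i * complex_of_real (A $ i $ j) * complex_of_real (x $ j))"
    unfolding pairing_def matrix_vector_mult_def by (simp add: sum_distrib_left mult.assoc)
  also have "\<dots> = (\<Sum>j\<in>UNIV. \<Sum>i\<in>UNIV. w $ i * complex_of_real (A $ i $ j) * complex_of_real (x $ j))"
    by (rule sum.swap)
  also have "\<dots> = pairing (w v* cmat A) x"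
    unfolding pairing_def vector_matrix_mult_def cmat_def by (simp add: sum_distrib_right)
  finally show ?thesis .
qed

lemma pairing_column: "pairing w (column j A) = (w v* cmat A) $ j"
  unfolding pairing_def vector_matrix_mult_def cmat_def column_def by simp

lemma pairing_axis: "pairing w (axis i 1) = w $ i"
  unfolding pairing_def axis_def by (simp add: if_distrib sum.delta cong: if_cong)

lemma pairing_add_left: "pairing (v + w) x = pairing v x + pairing w x"
  unfolding pairing_def by (simp add: distrib_right sum.distrib)

lemma pairing_scale_left: "pairing (c *s w) x = c * pairing w x"
  unfolding pairing_def by (simp add: sum_distrib_left mult.assoc)

lemma pairing_zero_left: "pairing 0 x = 0"
  unfolding pairing_def by simp

lemma pairing_scaleR_add_right:
  "pairing w (c *\<^sub>R x + y) = complex_of_real c * pairing w x + pairing w y"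
  unfolding pairing_def by (simp add: sum.distrib sum_distrib_left algebra_simps)

lemma pbh_block_row_Inl: "(v v* pbh_block D H S z) $ Inl j = (v v* cmat D) $ j - z * v $ j"
proof -
  have "(v v* pbh_block D H S z) $ Inl j
      = (\<Sum>i\<in>UNIV. v $ i * complex_of_real (D $ i $ j)) - (\<Sum>i\<in>UNIV. if i = j then v $ i * z else 0)"
    unfolding vector_matrix_mult_def pbh_block_def
    by (simp add: right_diff_distrib sum_subtractf if_distrib[of "\<lambda>a. v $ _ * a"] cong: if_cong)
  then show ?thesis unfolding vector_matrix_mult_def cmat_def by (simp add: mult.commute)
qed

lemma pbh_block_row_Inr:
  "(v v* pbh_block D H S z) $ Inr j = (if j \<in> S then (v v* cmat H) $ j else 0)"
  unfolding vector_matrix_mult_def pbh_block_def cmat_def by simp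

text \<open>If the Krylov vectors of \<open>S\<close> do not span, the complex vectors annihilating all of them form a
  nonzero subspace invariant under the transpose of \<open>D\<close>; an eigenvector in it makes a row
  combination of the PBH matrix vanish.\<close>
lemma pbh_imp_span_krylov_vecs:
  fixes D :: "real^'n^'n" and H :: "real^'l^'n"
  assumes "\<forall>z. rank (pbh_block D H S z) = CARD('n)"
  shows "span (krylov_vecs D H S) = UNIV"
proof (rule ccontr)
  assume "span (krylov_vecs D H S) \<noteq> UNIV"
  then have "dim (krylov_vecs D H S) < DIM(real^'n)"
    using dim_eq_full dim_subset_UNIV le_neq_implies_less by blast
  then obtain x :: "real^'n" where x: "x \<noteq> 0" "\<And>y. y \<in> span (krylov_vecs D H S) \<Longrightarrow> x \<bullet> y = 0"
    using orthogonal_to_subspace_exists unfolding orthogonal_def by blast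
  define W where "W = {w. \<forall>y\<in>krylov_vecs D H S. pairing w y = 0}"
  have "vec.subspace W"
    unfolding W_def vec.subspace_def
      by (simp add: pairing_add_left pairing_scale_left pairing_zero_left)
  moreover have "(*v) (transpose (cmat D)) ` W \<subseteq> W"
    using krylov_vecs_invariant[of D H S] unfolding W_def
      by (auto simp: pairing_matrix_vector_mult[symmetric])
  moreover define w where "w = (\<chi> i. complex_of_real (x $ i))"
  have "w \<in> W"
    using x(2)[OF span_base] unfolding W_def w_def pairing_def inner_vec_def
      by (simp flip: of_real_mult of_real_sum)
  moreover have "w \<noteq> 0" using x(1) unfolding w_def by (simp add: vec_eq_iff)
  ultimately obtain v z where v: "v \<in> W" "v \<noteq> 0" "v v* cmat D = z *s v"
    using invariant_subspace_has_eigenvector[of W "transpose (cmat D)" w] by auto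
  have columns: "column c H \<in> krylov_vecs D H S" if "c \<in> S" for c
    using column_set_subset_krylov_vecs[of H S D] that by blast
  have "(v v* pbh_block D H S z) $ c = 0" for c
  proof (cases c)
    case (Inl j)
    then show ?thesis using v(3) by (simp add: pbh_block_row_Inl vec_eq_iff)
  next
    case (Inr j)
    then show ?thesis
      using v(1) columns unfolding W_def by (auto simp: pbh_block_row_Inr pairing_column[symmetric])
  qed
  then have "v v* pbh_block D H S z = 0" by (simp add: vec_eq_iff)
  then have "rank (pbh_block D H S z) < CARD('n)" by (rule rank_less_card_if_left_null[OF v(2)])
  then show False using assms by simp
qed

lemma span_krylov_vecs_imp_pbh:
  fixes D :: "real^'n^'n" and H :: "real^'l^'n"
  assumes "span (krylov_vecs D H S) = UNIV"
  shows "rank (pbh_block D H S z) = CARD('n)"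
proof (rule rank_eq_card_if_left_null_trivial)
  fix v assume v: "v v* pbh_block D H S z = 0"
  then have eigen: "v v* cmat D = z *s v"
    using pbh_block_row_Inl[of v D H S z] by (simp add: vec_eq_iff)
  have columns: "pairing v (column c H) = 0" if "c \<in> S" for c
    using v pbh_block_row_Inr[of v D H S z c] that by (simp add: pairing_column vec_eq_iff)
  have powers: "pairing v (mat_pow D k *v y) = z ^ k * pairing v y" for k y
  proof (induction k arbitrary: y)
    case (Suc k)
    have "pairing v (mat_pow D (Suc k) *v y) = pairing v (mat_pow D k *v (D *v y))"
      by (simp only: mat_pow_Suc_mult_vec')
    also have "\<dots> = z ^ k * pairing v (D *v y)" by (rule Suc)
    also have "\<dots> = z ^ Suc k * pairing v y"
      by (simp add: pairing_matrix_vector_mult eigen pairing_scale_left)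
    finally show ?case .
  qed simp
  have "pairing v y = 0" if "y \<in> span (krylov_vecs D H S)" for y
    using that
  proof (induction rule: span_induct_alt)
    case base
    show ?case by (simp add: pairing_def)
  next
    case (step c g y)
    then obtain k j where "j \<in> S" "g = mat_pow D k *v column j H" unfolding krylov_vecs_def by blast
    then show ?case using step.IH powers columns by (simp add: pairing_scaleR_add_right)
  qed
  then have "v $ i = 0" for i using pairing_axis[of v i] assms by simp
  then show "v = 0" by (simp add: vec_eq_iff)
qed

lemma Sstar_witness:
  fixes D :: "real^'n^'n" and H :: "real^'l^'n"
  assumes "span (krylov_vecs D H UNIV) = UNIV"
  obtains S where "card S = Sstar D H" "span (krylov_vecs D H S) = UNIV"
proof -
  have "\<exists>S. card S = card (UNIV :: 'l set) \<and> (\<forall>z. rank (pbh_block D H S z) = CARD('n))"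
    using span_krylov_vecs_imp_pbh[OF assms] by blast
  then have "\<exists>S. card S = Sstar D H \<and> (\<forall>z. rank (pbh_block D H S z) = CARD('n))"
    unfolding Sstar_def by (rule LeastI)
  then show ?thesis using that pbh_imp_span_krylov_vecs by blast
qed

lemma min_poly_degree_witness:
  fixes D :: "real^'n^'n"
  obtains p :: "real poly" where "lead_coeff p = 1" "degree p = min_poly_degree D" "poly_mat p D = 0"
proof -
  have "\<exists>d p. lead_coeff p = 1 \<and> degree p = d \<and> poly_mat p D = 0"
    using exists_annihilating_poly[of D] by blast
  then have "\<exists>p::real poly. lead_coeff p = 1 \<and> degree p = min_poly_degree D \<and> poly_mat p D = 0"
    unfolding min_poly_degree_def by (rule LeastI_ex)
  then show ?thesis using that by blast
qed

text \<open>The last input of a steering sequence must supply a complement of the range of \<open>D\<close>.\<close>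
lemma exists_columns_complementing_range:
  fixes D :: "real^'n^'n" and H :: "real^'l^'n"
  assumes "steerable_in D H s K" "span (krylov_vecs D H S) = UNIV"
  shows "\<exists>G0\<subseteq>S. card G0 \<le> s \<and> span (column_set H G0 \<union> range ((*v) D)) = UNIV"
proof -
  obtain T where T: "\<forall>k. card (T k) \<le> s" "span (pattern_vecs D H T K) = UNIV"
    using assms(1) steerable_in_iff_span_pattern_vecs by blast
  have "CARD('n) = dim (pattern_vecs D H T K)" using T(2) dim_span[of "pattern_vecs D H T K"] by simp
  also have "\<dots> \<le> dim (range ((*v) D) \<union> column_set H (T 0))"
    by (rule dim_subset[OF pattern_vecs_subset_range_Un])
  also have "\<dots> \<le> dim (range ((*v) D)) + dim (column_set H (T 0))" by (rule dim_Un_le)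
  also have "dim (column_set H (T 0)) \<le> card (column_set H (T 0))"
    by (rule dim_le_card[OF span_superset]) simp
  also have "\<dots> \<le> s" using card_image_le[of "T 0" "\<lambda>c. column c H"] T(1) by (meson finite order_trans)
  finally have codim: "CARD('n) \<le> dim (range ((*v) D)) + s" by simp
  have "span (krylov_vecs D H S) \<subseteq> span (range ((*v) D) \<union> column_set H S)"
    by (rule span_mono[OF krylov_vecs_subset_range_Un])
  then have spans: "span (range ((*v) D) \<union> column_set H S) = UNIV" using assms(2) by auto
  obtain G0 where G0: "G0 \<subseteq> S" "card G0 = dim (range ((*v) D) \<union> column_set H S) - dim (range ((*v) D))"
      "span (range ((*v) D) \<union> column_set H G0) = span (range ((*v) D) \<union> column_set H S)"
    using exists_subset_span_eq[of S "range ((*v) D)" "\<lambda>c. column c H"] by auto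
  have "dim (range ((*v) D) \<union> column_set H S) = CARD('n)"
    using spans dim_span[of "range ((*v) D) \<union> column_set H S"] by simp
  then have "card G0 \<le> s" using G0(2) codim by simp
  moreover have "span (column_set H G0 \<union> range ((*v) D)) = UNIV" using G0(3) spans
    by (simp add: Un_commute)
  ultimately show ?thesis using G0(1) by blast
qed

lemma le_nat_ceiling_divide_mult:
  assumes "0 < s"
  shows "m \<le> nat \<lceil>real m / real s\<rceil> * s"
proof -
  have "real m / real s \<le> real (nat \<lceil>real m / real s\<rceil>)"
    using le_of_int_ceiling[of "real m / real s"] by simp
  then have "real m \<le> real (nat \<lceil>real m / real s\<rceil>) * real s"
    by (subst (asm) pos_divide_le_eq) (use assms in simp_all)
  then show ?thesis by (simp only: of_nat_mult[symmetric] of_nat_le_iff)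
qed

lemma krylov_vecs_spanning_nonempty:
  assumes "span (krylov_vecs D H S) = (UNIV :: (real^'n) set)"
  shows "S \<noteq> {}"
proof
  assume "S = {}"
  then have "span (krylov_vecs D H S) = {0}" unfolding krylov_vecs_def by simp
  moreover have "(axis undefined 1 :: real^'n) \<noteq> 0" by (simp add: axis_eq_0_iff)
  ultimately show False using assms by (metis UNIV_I singletonD)
qed

lemma Kstar_le_min_poly_degree_mult:
  fixes D :: "real^'n^'n" and H :: "real^'l^'n"
  assumes "0 < s" "sparse_controllable D H s"
  shows "int (Kstar D H s) \<le> int (min_poly_degree D) * \<lceil>real (Sstar D H) / real s\<rceil>"
proof -
  have steer: "steerable_in D H s (Kstar D H s)"
    by (rule sparse_controllable_imp_steerable_in[OF assms(2)])
  then obtain T where "span (pattern_vecs D H T (Kstar D H s)) = UNIV"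
    using steerable_in_iff_span_pattern_vecs by blast
  moreover have "span (pattern_vecs D H T (Kstar D H s)) \<subseteq> span (krylov_vecs D H UNIV)"
    by (intro span_mono pattern_vecs_subset_krylov_vecs) simp
  ultimately obtain S where S: "card S = Sstar D H" "span (krylov_vecs D H S) = UNIV"
    using Sstar_witness by (metis top.extremum_uniqueI)
  obtain G0 where G0: "G0 \<subseteq> S" "card G0 \<le> s" "span (column_set H G0 \<union> range ((*v) D)) = UNIV"
    using exists_columns_complementing_range[OF steer S(2)] by blast
  obtain p where p: "lead_coeff p = 1" "degree p = min_poly_degree D" "poly_mat p D = 0"
    by (rule min_poly_degree_witness)
  define g where "g = nat \<lceil>real (Sstar D H) / real s\<rceil>"
  have card_S: "card S \<le> g * s" unfolding g_def S(1) by (rule le_nat_ceiling_divide_mult[OF assms(1)])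
  have "0 < card S" using krylov_vecs_spanning_nonempty[OF S(2)] by (simp add: card_gt_0_iff)
  then have "0 < g" using card_S by (cases g) auto
  then have "steerable_in D H s (degree p * g)" by (rule steerable_in_blocks[OF S(2) G0 p(1,3) card_S])
  then have "Kstar D H s \<le> min_poly_degree D * g" unfolding p(2) by (rule Kstar_le)
  then have "int (Kstar D H s) \<le> int (min_poly_degree D) * int g"
    by (simp only: of_nat_mult[symmetric] of_nat_le_iff)
  moreover have "0 \<le> \<lceil>real (Sstar D H) / real s\<rceil>"
    using ceiling_mono[of 0 "real (Sstar D H) / real s"] by simp
  ultimately show ?thesis unfolding g_def by simp
qed

theorem theorem3:
  fixes D :: "real^'n^'n" and H :: "real^'l^'n" and s :: nat
  assumes "0 < s" and "s \<le> CARD('l)"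
    and "sparse_controllable D H s"
  shows "real CARD('n) / real (Rstar H s) \<le> real (Kstar D H s)
       \<and> int (Kstar D H s) \<le> min (int (min_poly_degree D) * \<lceil>real (Sstar D H) / real s\<rceil>)
                                  (int CARD('n) - int (Rstar H s) + 1)
       \<and> min (int (min_poly_degree D) * \<lceil>real (Sstar D H) / real s\<rceil>)
             (int CARD('n) - int (Rstar H s) + 1) \<le> int CARD('n)"
proof -
  have lower: "CARD('n) \<le> Kstar D H s * Rstar H s"
    using card_le_mult_Rstar[OF sparse_controllable_imp_steerable_in[OF assms(3)]] .
  then have "0 < Rstar H s" by (cases "Rstar H s") simp_all
  have "int (Kstar D H s + Rstar H s) \<le> int (CARD('n) + 1)"
    using Kstar_add_Rstar_le[OF assms(1,3)] by (simp only: of_nat_le_iff)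
  then have by_rank: "int (Kstar D H s) \<le> int CARD('n) - int (Rstar H s) + 1" by simp
  have by_min_poly: "int (Kstar D H s) \<le> int (min_poly_degree D) * \<lceil>real (Sstar D H) / real s\<rceil>"
    by (rule Kstar_le_min_poly_degree_mult[OF assms(1,3)])
  show ?thesis
  proof (intro conjI)
    show "real CARD('n) / real (Rstar H s) \<le> real (Kstar D H s)"
      using lower \<open>0 < Rstar H s\<close> by (simp add: divide_le_eq flip: of_nat_mult)
  qed (use by_rank by_min_poly \<open>0 < Rstar H s\<close> in \<open>auto simp: min_le_iff_disj\<close>)+
qed

end
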